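(* If $q=q_n\ge n^{2/3+\epsilon}$ for a constant $\epsilon>0$, then for any $D=D_n=o\big((\log n/\log\log n)^2\big)$ no polynomial of degree at most $D$ weakly separates $G(n,1/2)$ and $\mathcal{R}_q$.
   Context: Graphs on $[n]$ are encoded as $X\in\{\pm1\}^{\binom n2}$ ($+1$ = edge present, $-1$ = absent). $G(n,1/2)$ is the uniform distribution on $\{\pm1\}^{\binom n2}$. $\mathcal{R}_q$ is the set of $q$-colorable graphs. A polynomial $f$ weakly separates a distribution $\mathbb{Q}$ and a set $\mathcal{R}$ if $f(X)\ge1$ for all $X\in\mathcal{R}$, $\mathbb{E}_{\mathbb{Q}}[f]=0$, and $\mathbb{E}_{\mathbb{Q}}[f^2]=O(1)$ as $n\to\infty$. *)

theory Defs
  imports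
    "HOL-Probability.Probability"
    "HOL-Library.Poly_Mapping"
    "HOL-Library.Landau_Symbols"
begin

definition pairs :: "nat \<Rightarrow> nat set set" where
  "pairs n = {e. e \<subseteq> {1..n} \<and> card e = 2}"

type_synonym sgraph = "nat set \<Rightarrow> real"

definition graphs :: "nat \<Rightarrow> sgraph set" where
  "graphs n = (pairs n \<rightarrow>\<^sub>E {-1, 1})"

definition G_half :: "nat \<Rightarrow> sgraph pmf" where
  "G_half n = pmf_of_set (graphs n)"

text \<open>\<^const>\<open>pmf_of_set\<close> is only specified for finite nonempty sets.\<close>

lemma finite_pairs: "finite (pairs n)"
  by (rule finite_subset[of _ "Pow {1..n}"]) (auto simp: pairs_def)

lemma finite_graphs: "finite (graphs n)"
  by (simp add: graphs_def finite_pairs finite_PiE)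

lemma graphs_nonempty: "graphs n \<noteq> {}"
  by (simp add: graphs_def PiE_eq_empty_iff)

definition colorable :: "nat \<Rightarrow> nat \<Rightarrow> sgraph set" where
  "colorable n q = {X \<in> graphs n. \<exists>c. c ` {1..n} \<subseteq> {1..q} \<and>
     (\<forall>u\<in>{1..n}. \<forall>v\<in>{1..n}. u \<noteq> v \<and> X {u, v} = 1 \<longrightarrow> c u \<noteq> c v)}"

text \<open>
  Real multivariate polynomials in variables indexed by sets of vertices: finitely supported
  coefficient functions on monomials, a monomial being a finitely supported exponent function.
\<close>

type_synonym gpoly = "(nat set \<Rightarrow>\<^sub>0 nat) \<Rightarrow>\<^sub>0 real"

definition poly_vars :: "gpoly \<Rightarrow> nat set set" where
  "poly_vars p = (\<Union>m\<in>Poly_Mapping.keys p. Poly_Mapping.keys m)"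

definition monom_degree :: "(nat set \<Rightarrow>\<^sub>0 nat) \<Rightarrow> nat" where
  "monom_degree m = (\<Sum>e\<in>Poly_Mapping.keys m. Poly_Mapping.lookup m e)"

text \<open>The zero polynomial gets degree 0.\<close>

definition total_degree :: "gpoly \<Rightarrow> nat" where
  "total_degree p = Max (insert 0 (monom_degree ` Poly_Mapping.keys p))"

definition poly_eval :: "gpoly \<Rightarrow> sgraph \<Rightarrow> real" where
  "poly_eval p X = (\<Sum>m\<in>Poly_Mapping.keys p. Poly_Mapping.lookup p m *
     (\<Prod>e\<in>Poly_Mapping.keys m. X e ^ Poly_Mapping.lookup m e))"

text \<open>
  Weak separation is a statement about a sequence of polynomials, one for each \<open>n\<close>, in the limit
  of large \<open>n\<close>; all conditions are therefore imposed only for sufficiently large \<open>n\<close>. (Imposing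
  them for every \<open>n\<close> would make weak separation of the uniform distribution and the \<open>q\<close>-colorable
  graphs impossible for a trivial reason whenever \<open>q \<ge> n\<close> for a single \<open>n\<close>: then all graphs are
  colorable, so that \<open>f \<ge> 1\<close> everywhere.)
\<close>

definition weakly_separates ::
    "(nat \<Rightarrow> gpoly) \<Rightarrow> (nat \<Rightarrow> sgraph pmf) \<Rightarrow> (nat \<Rightarrow> sgraph set) \<Rightarrow> bool" where
  "weakly_separates f Q R \<longleftrightarrow>
     (\<forall>\<^sub>F n in sequentially. poly_vars (f n) \<subseteq> pairs n) \<and>
     (\<forall>\<^sub>F n in sequentially. \<forall>X\<in>R n. poly_eval (f n) X \<ge> 1) \<and>
     (\<forall>\<^sub>F n in sequentially. measure_pmf.expectation (Q n) (poly_eval (f n)) = 0) \<and>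
     (\<lambda>n. measure_pmf.expectation (Q n) (\<lambda>X. (poly_eval (f n) X)\<^sup>2)) \<in> O(\<lambda>_. 1)"

end

theory Submission
  imports Defs
begin

text \<open>
  A planted distribution supported on \<open>q\<close>-colorable graphs, matching \<open>G(n, 1/2)\<close> on low-degree
  polynomials, rules out weak separation. Planting only a \<open>q\<close>-coloring is not quiet enough: triangles
  detect it as soon as \<open>q\<close> is below \<open>n\<^sup>3\<^sup>/\<^sup>4\<close>. Instead, give each vertex an independent uniform label in
  a \<open>q \<times> q\<close> grid; vertices in the same row are not adjacent, vertices in the same column
  (but distinct rows) are adjacent, and all other pairs are fair coins. The rows are a coloring, and
  the near symmetry under complementation makes the biases of an edge, a path with two edges and a
  triangle \<open>O(q\<^sup>-\<^sup>2)\<close>, \<open>O(q\<^sup>-\<^sup>4)\<close> and \<open>O(q\<^sup>-\<^sup>3)\<close>. A connected graph on \<open>v\<close> vertices has bias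
  at most \<open>(2/q)\<close> to the power \<open>v - 1\<close>, by revealing a spanning tree. As biases multiply over components, an
  edge set covering \<open>v\<close> vertices has squared bias at most \<open>(4 q\<^sup>-\<^sup>3\<^sup>/\<^sup>2)\<close> to the power \<open>v\<close>. There are at most
  \<open>B\<close> to the power \<open>v\<close> sets of at most \<open>D\<close> edges with a given span of size \<open>v\<close>, where \<open>B\<close> is
  \<open>1 + 4 D\<^sup>2\<close> to the power \<open>sqrt D\<close>, which is \<open>n\<close> to the power \<open>o(1)\<close>. Hence the squared biases
  of all nonempty edge sets sum to \<open>o(1)\<close>, and Cauchy-Schwarz contradicts \<open>f \<ge> 1\<close>.
\<close>

section \<open>Averages over finite sets and independent labels\<close>

definition avg :: "'a set \<Rightarrow> ('a \<Rightarrow> real) \<Rightarrow> real" where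
  "avg A f = (\<Sum>x\<in>A. f x) / real (card A)"

lemma avg_cong: "(\<And>x. x \<in> A \<Longrightarrow> f x = g x) \<Longrightarrow> avg A f = avg A g"
  by (simp add: avg_def)

lemma avg_add: "avg A (\<lambda>x. f x + g x) = avg A f + avg A g"
  by (simp add: avg_def sum.distrib add_divide_distrib)

lemma avg_diff: "avg A (\<lambda>x. f x - g x) = avg A f - avg A g"
  by (simp add: avg_def sum_subtractf diff_divide_distrib)

lemma avg_uminus: "avg A (\<lambda>x. - f x) = - avg A f"
  by (simp add: avg_def sum_negf)

lemma avg_cmult: "avg A (\<lambda>x. c * f x) = c * avg A f"
  by (simp add: avg_def sum_distrib_left)

lemma avg_multc: "avg A (\<lambda>x. f x * c) = avg A f * c"
  by (simp add: avg_def sum_distrib_right)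

lemma avg_const: "finite A \<Longrightarrow> A \<noteq> {} \<Longrightarrow> avg A (\<lambda>_. c) = c"
  by (simp add: avg_def)

lemma avg_sum: "avg A (\<lambda>x. \<Sum>i\<in>I. f i x) = (\<Sum>i\<in>I. avg A (f i))"
  unfolding avg_def by (subst sum.swap) (simp add: sum_divide_distrib)

lemma avg_mono: "(\<And>x. x \<in> A \<Longrightarrow> f x \<le> g x) \<Longrightarrow> avg A f \<le> avg A g"
  by (simp add: avg_def divide_right_mono sum_mono)

lemma avg_nonneg: "(\<And>x. x \<in> A \<Longrightarrow> 0 \<le> f x) \<Longrightarrow> 0 \<le> avg A f"
  by (simp add: avg_def sum_nonneg)

lemma abs_avg_le: "\<bar>avg A f\<bar> \<le> avg A (\<lambda>x. \<bar>f x\<bar>)"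
  by (simp add: avg_def divide_right_mono sum_abs)

lemma avg_swap: "avg A (\<lambda>x. avg B (f x)) = avg B (\<lambda>y. avg A (\<lambda>x. f x y))"
proof -
  have "(\<Sum>x\<in>A. \<Sum>y\<in>B. f x y) = (\<Sum>y\<in>B. \<Sum>x\<in>A. f x y)"
    by (rule sum.swap)
  then show ?thesis
    by (simp add: avg_def mult.commute flip: sum_divide_distrib)
qed

lemma avg_Times: "avg (A \<times> B) (\<lambda>x. f (fst x) * g (snd x)) = avg A f * avg B g"
  by (simp add: avg_def card_cartesian_product sum_product sum.cartesian_product case_prod_unfold)

lemma avg_of_bool_eq:
  "finite A \<Longrightarrow> y \<in> A \<Longrightarrow> avg A (\<lambda>x. of_bool (x = y)) = 1 / real (card A)"
  by (simp add: avg_def Int_insert_right)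

text \<open>A labelling is determined by its value at \<open>w\<close> and its restriction to the
  other vertices; overwriting the value at \<open>w\<close> makes the old one contribute only a
  factor \<open>card L\<close>. This isolates the average over the label of a single vertex.\<close>

lemma avg_PiE_resample:
  assumes V: "finite V" "w \<in> V" and L: "finite L" "L \<noteq> {}"
  shows "avg (V \<rightarrow>\<^sub>E L) f = avg (V \<rightarrow>\<^sub>E L) (\<lambda>l. avg L (\<lambda>x. f (l(w := x))))"
proof -
  define V' where "V' = V - {w}"
  have V': "V = insert w V'" "w \<notin> V'" using V by (auto simp: V'_def)
  have split: "(\<Sum>l\<in>V \<rightarrow>\<^sub>E L. g l) = (\<Sum>x\<in>L. \<Sum>l\<in>V' \<rightarrow>\<^sub>E L. g (l(w := x)))"
    for g :: "_ \<Rightarrow> real"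
  proof -
    have "(\<Sum>l\<in>V \<rightarrow>\<^sub>E L. g l) =
      (\<Sum>l\<in>(\<lambda>(y, h). h(w := y)) ` (L \<times> (V' \<rightarrow>\<^sub>E L)). g l)"
      by (simp add: V'(1) PiE_insert_eq)
    also have "\<dots> = (\<Sum>(y, h)\<in>L \<times> (V' \<rightarrow>\<^sub>E L). g (h(w := y)))"
      using inj_combinator[OF V'(2), of "\<lambda>_. L"]
      by (subst sum.reindex) (auto simp: case_prod_unfold)
    finally show ?thesis by (simp add: sum.cartesian_product)
  qed
  have "(\<Sum>l\<in>V \<rightarrow>\<^sub>E L. avg L (\<lambda>x. f (l(w := x))))
    = real (card L) * (\<Sum>l\<in>V' \<rightarrow>\<^sub>E L. avg L (\<lambda>x. f (l(w := x))))"
    by (simp add: split)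
  also have "\<dots> = (\<Sum>l\<in>V' \<rightarrow>\<^sub>E L. \<Sum>x\<in>L. f (l(w := x)))"
    using L by (simp add: avg_def flip: sum_divide_distrib)
  also have "\<dots> = (\<Sum>l\<in>V \<rightarrow>\<^sub>E L. f l)"
    by (subst split) (rule sum.swap)
  finally show ?thesis by (simp add: avg_def[of "V \<rightarrow>\<^sub>E L"])
qed

text \<open>Arbitrary functions are compared, not only labellings of a given vertex set, so that
  updated labellings need no membership check.\<close>

definition depends_on :: "'a set \<Rightarrow> (('a \<Rightarrow> 'b) \<Rightarrow> 'c) \<Rightarrow> bool" where
  "depends_on A f \<longleftrightarrow> (\<forall>l l'. (\<forall>a\<in>A. l a = l' a) \<longrightarrow> f l = f l')"

lemma depends_onD: "depends_on A f \<Longrightarrow> (\<And>a. a \<in> A \<Longrightarrow> l a = l' a) \<Longrightarrow> f l = f l'"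
  unfolding depends_on_def by blast

text \<open>The coordinates of \<open>A\<close> are averaged out one at a time: \<open>g\<close>
  does not see them and passes through each average, and once none is left \<open>f\<close> is
  constant. This is the independence of labels on disjoint vertex sets.\<close>

lemma avg_PiE_mult:
  fixes f g :: "('a \<Rightarrow> 'b) \<Rightarrow> real"
  assumes V: "finite V" and L: "finite L" "L \<noteq> {}" and "A \<subseteq> V" "A \<inter> B = {}"
    and "depends_on A f" and g: "depends_on B g"
  shows "avg (V \<rightarrow>\<^sub>E L) (\<lambda>l. f l * g l) = avg (V \<rightarrow>\<^sub>E L) f * avg (V \<rightarrow>\<^sub>E L) g"
proof -
  have "finite A" using \<open>A \<subseteq> V\<close> V finite_subset by blast
  then show ?thesis
    using assms(4-6)
  proof (induction A arbitrary: f rule: finite_induct)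
    case empty
    have "f = (\<lambda>_. f undefined)"
      using empty.prems(3) unfolding depends_on_def by blast
    then obtain c where c: "f = (\<lambda>_. c)" by blast
    have "finite (V \<rightarrow>\<^sub>E L)" "(V \<rightarrow>\<^sub>E L) \<noteq> {}"
      using V L by (auto simp: finite_PiE PiE_eq_empty_iff)
    then show ?case by (simp add: c avg_cmult avg_const)
  next
    case (insert w A)
    let ?f = "\<lambda>l. avg L (\<lambda>x. f (l(w := x)))"
    have w: "w \<in> V" "w \<notin> B" using insert.prems by auto
    have f: "depends_on A ?f"
      unfolding depends_on_def
    proof (intro allI impI avg_cong)
      fix l l' :: "'a \<Rightarrow> 'b" and x assume "\<forall>a\<in>A. l a = l' a"
      then show "f (l(w := x)) = f (l'(w := x))"
        by (intro depends_onD[OF insert.prems(3)]) auto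
    qed
    have "g (l(w := x)) = g l" for l x
      using w by (intro depends_onD[OF g]) auto
    then have "avg (V \<rightarrow>\<^sub>E L) (\<lambda>l. f l * g l) = avg (V \<rightarrow>\<^sub>E L) (\<lambda>l. ?f l * g l)"
      by (subst avg_PiE_resample[OF V w(1) L]) (simp add: avg_multc)
    also have "\<dots> = avg (V \<rightarrow>\<^sub>E L) ?f * avg (V \<rightarrow>\<^sub>E L) g"
      using insert.prems by (intro insert.IH f) auto
    also have "avg (V \<rightarrow>\<^sub>E L) ?f = avg (V \<rightarrow>\<^sub>E L) f"
      by (rule avg_PiE_resample[OF V w(1) L, symmetric])
    finally show ?case .
  qed
qed

section \<open>Biases of edge sets under the grid labelling\<close>

text \<open>
  The conditional expectation of the edge variable given the labels (row, column).
\<close>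

definition edge_bias :: "('v \<Rightarrow> 'r \<times> 'c) \<Rightarrow> 'v set \<Rightarrow> real" where
  "edge_bias l e =
     (if \<forall>u\<in>e. \<forall>v\<in>e. fst (l u) = fst (l v) then - 1
      else if \<forall>u\<in>e. \<forall>v\<in>e. snd (l u) = snd (l v) then 1 else 0)"

text \<open>The product term corrects the case where row and column both agree, in which the row
  rule wins. In this polynomial form averages can be taken term by term.\<close>

lemma edge_bias_pair:
  "edge_bias l {u, v} = - of_bool (fst (l u) = fst (l v)) + of_bool (snd (l u) = snd (l v))
     - of_bool (fst (l u) = fst (l v)) * of_bool (snd (l u) = snd (l v))"
  by (cases "fst (l u) = fst (l v)"; cases "snd (l u) = snd (l v)") (simp_all add: edge_bias_def)

lemma abs_edge_bias_le_1: "\<bar>edge_bias l e\<bar> \<le> 1"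
  by (simp add: edge_bias_def)

lemma edge_bias_cong:
  assumes "\<And>v. v \<in> e \<Longrightarrow> l v = l' v"
  shows "edge_bias l e = edge_bias l' e"
proof -
  have "(\<forall>u\<in>e. \<forall>v\<in>e. fst (l u) = fst (l v)) \<longleftrightarrow> (\<forall>u\<in>e. \<forall>v\<in>e. fst (l' u) = fst (l' v))"
    "(\<forall>u\<in>e. \<forall>v\<in>e. snd (l u) = snd (l v)) \<longleftrightarrow> (\<forall>u\<in>e. \<forall>v\<in>e. snd (l' u) = snd (l' v))"
    using assms by (intro ball_cong refl, metis)+
  then show ?thesis by (simp only: edge_bias_def)
qed

abbreviation labels :: "nat \<Rightarrow> (nat \<times> nat) set" where
  "labels q \<equiv> {1..q} \<times> {1..q}"

text \<open>Given the labels, the edge variables are independent. For a set \<open>S\<close> of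
  vertex pairs this is therefore the planted expectation of the product of the variables in
  \<open>S\<close>, a Fourier coefficient of the likelihood ratio.\<close>

definition mean_bias :: "'v set \<Rightarrow> nat \<Rightarrow> 'v set set \<Rightarrow> real" where
  "mean_bias V q S = avg (V \<rightarrow>\<^sub>E labels q) (\<lambda>l. \<Prod>e\<in>S. edge_bias l e)"

lemma depends_on_prod_edge_bias:
  "depends_on (\<Union>S) (\<lambda>l. \<Prod>e\<in>S. edge_bias l e)"
  unfolding depends_on_def
proof (intro allI impI)
  fix l l' :: "'a \<Rightarrow> 'b \<times> 'c"
  assume "\<forall>a\<in>\<Union>S. l a = l' a"
  then have "edge_bias l e = edge_bias l' e" if "e \<in> S" for e
    using that by (intro edge_bias_cong) blast
  then show "(\<Prod>e\<in>S. edge_bias l e) = (\<Prod>e\<in>S. edge_bias l' e)"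
    by (rule prod.cong[OF refl])
qed

text \<open>Labels on disjoint vertex sets are independent. Disjointness of \<open>S\<close> and
  \<open>T\<close> is a condition of its own, since the empty set could belong to both.\<close>

lemma mean_bias_Un:
  assumes "finite V" "q > 0" "finite S" "finite T" "\<Union>S \<subseteq> V" "\<Union>S \<inter> \<Union>T = {}" "S \<inter> T = {}"
  shows "mean_bias V q (S \<union> T) = mean_bias V q S * mean_bias V q T"
proof -
  have "mean_bias V q (S \<union> T) =
    avg (V \<rightarrow>\<^sub>E labels q) (\<lambda>l. (\<Prod>e\<in>S. edge_bias l e) * (\<Prod>e\<in>T. edge_bias l e))"
    using assms by (simp add: mean_bias_def prod.union_disjoint)
  also have "\<dots> = mean_bias V q S * mean_bias V q T"
    unfolding mean_bias_def
  proof (rule avg_PiE_mult[OF _ _ _ _ _ depends_on_prod_edge_bias depends_on_prod_edge_bias])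
    show "labels q \<noteq> {}" using \<open>q > 0\<close> by simp
  qed (use assms in simp_all)
  finally show ?thesis .
qed

section \<open>Exact mean biases of an edge, a path with two edges and a triangle\<close>

lemma avg_labels:
  assumes "q > 0"
  shows "avg (labels q) (\<lambda>x. f (fst x)) = avg {1..q} f"
    and "avg (labels q) (\<lambda>x. g (snd x)) = avg {1..q} g"
  using avg_Times[of "{1..q}" "{1..q}" f "\<lambda>_. 1"] avg_Times[of "{1..q}" "{1..q}" "\<lambda>_. 1" g] assms
  by (simp_all add: avg_const)

lemma avg_same_label:
  assumes "a \<in> {1..q}"
  shows "avg {1..q} (\<lambda>x. of_bool (x = a)) = 1 / real q"
    and "avg {1..q} (\<lambda>x. of_bool (x = a) * of_bool (x = b)) = of_bool (a = b) / real q"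
proof -
  show *: "avg {1..q} (\<lambda>x. of_bool (x = a)) = 1 / real q"
    using avg_of_bool_eq[of "{1..q}" a] assms by simp
  have "avg {1..q} (\<lambda>x. of_bool (x = a) * of_bool (x = b)) =
    avg {1..q} (\<lambda>x. of_bool (x = a) * of_bool (a = b))"
    by (rule avg_cong) auto
  then show "avg {1..q} (\<lambda>x. of_bool (x = a) * of_bool (x = b)) = of_bool (a = b) / real q"
    by (simp only: avg_multc *) simp
qed

lemma avg_labels_same:
  assumes "a \<in> {1..q}" "b \<in> {1..q}"
  shows "avg (labels q) (\<lambda>x. of_bool (fst x = a)) = 1 / real q"
    and "avg (labels q) (\<lambda>x. of_bool (snd x = b)) = 1 / real q"
    and "avg (labels q) (\<lambda>x. of_bool (fst x = a) * of_bool (snd x = b)) = 1 / real q * (1 / real q)"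
proof -
  have "q > 0" using assms by simp
  note lab = avg_labels[OF this]
  show "avg (labels q) (\<lambda>x. of_bool (fst x = a)) = 1 / real q"
    using lab(1)[of "\<lambda>y. of_bool (y = a)"] avg_same_label(1)[OF assms(1)] by simp
  show "avg (labels q) (\<lambda>x. of_bool (snd x = b)) = 1 / real q"
    using lab(2)[of "\<lambda>y. of_bool (y = b)"] avg_same_label(1)[OF assms(2)] by simp
  show "avg (labels q) (\<lambda>x. of_bool (fst x = a) * of_bool (snd x = b)) = 1 / real q * (1 / real q)"
    using avg_Times[of "{1..q}" "{1..q}" "\<lambda>y. of_bool (y = a)" "\<lambda>y. of_bool (y = b)"]
      avg_same_label(1)[OF assms(1)] avg_same_label(1)[OF assms(2)] by simp
qed

text \<open>Sharing a row and sharing a column both have probability \<open>1 / q\<close> and enter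
  with opposite signs; they cancel, and only the event of sharing both is left.\<close>

lemma avg_edge_bias:
  assumes "u \<noteq> v" "l v \<in> labels q"
  shows "avg (labels q) (\<lambda>x. edge_bias (l(u := x)) {u, v}) = - 1 / (real q)\<^sup>2"
proof -
  obtain r c where l: "l v = (r, c)" "r \<in> {1..q}" "c \<in> {1..q}" using assms(2) by auto
  have "avg (labels q) (\<lambda>x. edge_bias (l(u := x)) {u, v}) =
    avg (labels q) (\<lambda>x. - of_bool (fst x = r) + of_bool (snd x = c) - of_bool (fst x = r) * of_bool (snd x = c))"
    using assms(1)[symmetric] l(1) by (simp only: simp_thms edge_bias_pair fun_upd_same fun_upd_other fst_conv snd_conv)
  also have "\<dots> = - (1 / real q) + 1 / real q - (1 / real q) * (1 / real q)"
    using l by (simp only: avg_add avg_diff avg_uminus avg_labels_same)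
  finally show ?thesis by (simp add: power2_eq_square)
qed

text \<open>Row and column of the fresh label are independent, so each of the nine terms of the
  expanded product averages to a row factor times a column factor. The result is expressed by the
  coincidences between \<open>v\<close> and \<open>w\<close>, ready to be multiplied by the bias of
  \<open>{v, w}\<close> in a triangle.\<close>

lemma avg_edge_bias_mult:
  assumes "u \<noteq> v" "u \<noteq> w" "l v \<in> labels q" "l w \<in> labels q"
  shows "avg (labels q) (\<lambda>x. edge_bias (l(u := x)) {u, v} * edge_bias (l(u := x)) {u, w}) =
    (1 / real q + 2 / (real q)\<^sup>2) * of_bool (fst (l v) = fst (l w))
    + (1 / real q - 2 / (real q)\<^sup>2) * of_bool (snd (l v) = snd (l w))
    + of_bool (fst (l v) = fst (l w)) * of_bool (snd (l v) = snd (l w)) / (real q)\<^sup>2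
    - 2 / (real q)\<^sup>2"
proof -
  obtain r c where l: "l v = (r, c)" "r \<in> {1..q}" "c \<in> {1..q}" using assms(3) by auto
  obtain s d where m: "l w = (s, d)" "s \<in> {1..q}" "d \<in> {1..q}" using assms(4) by auto
  have "q > 0" using l by auto
  define R S C D :: "nat \<Rightarrow> real" where
    "R x = of_bool (x = r)" and "S x = of_bool (x = s)" and
    "C x = of_bool (x = c)" and "D x = of_bool (x = d)" for x
  have R: "avg {1..q} R = 1 / real q" and S: "avg {1..q} S = 1 / real q"
    and C: "avg {1..q} C = 1 / real q" and D: "avg {1..q} D = 1 / real q"
    and RS: "avg {1..q} (\<lambda>x. R x * S x) = of_bool (r = s) / real q"
    and CD: "avg {1..q} (\<lambda>x. C x * D x) = of_bool (c = d) / real q"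
    unfolding R_def S_def C_def D_def using l m by (simp_all only: avg_same_label)
  have "avg (labels q) (\<lambda>x. edge_bias (l(u := x)) {u, v} * edge_bias (l(u := x)) {u, w}) =
    avg (labels q) (\<lambda>x. (- R (fst x) + C (snd x) - R (fst x) * C (snd x)) *
      (- S (fst x) + D (snd x) - S (fst x) * D (snd x)))"
    using assms(1,2)[symmetric] l(1) m(1)
    by (simp only: simp_thms edge_bias_pair fun_upd_same fun_upd_other fst_conv snd_conv R_def S_def C_def D_def)
  also have "\<dots> = avg (labels q) (\<lambda>x.
      R (fst x) * S (fst x) - R (fst x) * D (snd x) + (R (fst x) * S (fst x)) * D (snd x)
      - S (fst x) * C (snd x) + C (snd x) * D (snd x) - S (fst x) * (C (snd x) * D (snd x))
      + (R (fst x) * S (fst x)) * C (snd x) - R (fst x) * (C (snd x) * D (snd x))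
      + (R (fst x) * S (fst x)) * (C (snd x) * D (snd x)))"
    by (rule avg_cong) (simp add: algebra_simps)
  also have "\<dots> = of_bool (r = s) / real q - 1 / real q * (1 / real q)
      + of_bool (r = s) / real q * (1 / real q) - 1 / real q * (1 / real q)
      + of_bool (c = d) / real q - 1 / real q * (of_bool (c = d) / real q)
      + of_bool (r = s) / real q * (1 / real q) - 1 / real q * (of_bool (c = d) / real q)
      + of_bool (r = s) / real q * (of_bool (c = d) / real q)"
    using avg_Times[of "{1..q}" "{1..q}" R D] avg_Times[of "{1..q}" "{1..q}" S C]
      avg_Times[of "{1..q}" "{1..q}" "\<lambda>x. R x * S x" D]
      avg_Times[of "{1..q}" "{1..q}" "\<lambda>x. R x * S x" C]
      avg_Times[of "{1..q}" "{1..q}" S "\<lambda>x. C x * D x"]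
      avg_Times[of "{1..q}" "{1..q}" R "\<lambda>x. C x * D x"]
      avg_Times[of "{1..q}" "{1..q}" "\<lambda>x. R x * S x" "\<lambda>x. C x * D x"]
      avg_labels(1)[OF \<open>q > 0\<close>, of "\<lambda>x. R x * S x"] avg_labels(2)[OF \<open>q > 0\<close>, of "\<lambda>x. C x * D x"]
    by (simp only: avg_add avg_diff R S C D RS CD)
  also have "\<dots> = (1 / real q + 2 / (real q)\<^sup>2) * of_bool (r = s)
    + (1 / real q - 2 / (real q)\<^sup>2) * of_bool (c = d)
    + of_bool (r = s) * of_bool (c = d) / (real q)\<^sup>2 - 2 / (real q)\<^sup>2"
    using \<open>q > 0\<close> by (cases "r = s"; cases "c = d") (simp_all add: power2_eq_square field_simps)
  finally show ?thesis by (simp only: l m fst_conv snd_conv)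
qed

lemma mean_bias_edge:
  assumes "finite V" "u \<in> V" "v \<in> V" "u \<noteq> v" "q > 0"
  shows "mean_bias V q {{u, v}} = - 1 / (real q)\<^sup>2"
proof -
  have L: "finite (labels q)" "labels q \<noteq> {}" using assms by auto
  have "mean_bias V q {{u, v}} =
    avg (V \<rightarrow>\<^sub>E labels q) (\<lambda>l. avg (labels q) (\<lambda>x. edge_bias (l(u := x)) {u, v}))"
    unfolding mean_bias_def by (subst avg_PiE_resample[OF assms(1,2) L]) simp
  also have "\<dots> = avg (V \<rightarrow>\<^sub>E labels q) (\<lambda>l. - 1 / (real q)\<^sup>2)"
    using assms by (intro avg_cong avg_edge_bias) auto
  finally show ?thesis
    using assms L by (simp add: avg_const finite_PiE PiE_eq_empty_iff)
qed

text \<open>The end vertex \<open>u\<close> lies only on the first edge: averaging over its label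
  gives \<open>- 1 / q^2\<close> whatever the label of \<open>v\<close>, and the remaining edge
  gives the same factor.\<close>

lemma mean_bias_path:
  assumes "finite V" "u \<in> V" "v \<in> V" "w \<in> V" "u \<noteq> v" "u \<noteq> w" "v \<noteq> w" "q > 0"
  shows "mean_bias V q {{u, v}, {v, w}} = 1 / real q ^ 4"
proof -
  have L: "finite (labels q)" "labels q \<noteq> {}" using assms by auto
  have ne: "{u, v} \<noteq> {v, w}" using assms by (auto simp: doubleton_eq_iff)
  have b: "edge_bias (l(u := x)) {v, w} = edge_bias l {v, w}" for l :: "'a \<Rightarrow> nat \<times> nat" and x
    using assms by (intro edge_bias_cong) auto
  have "mean_bias V q {{u, v}, {v, w}} =
    avg (V \<rightarrow>\<^sub>E labels q) (\<lambda>l. avg (labels q) (\<lambda>x. edge_bias (l(u := x)) {u, v} * edge_bias l {v, w}))"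
    unfolding mean_bias_def by (subst avg_PiE_resample[OF assms(1,2) L]) (simp add: ne b)
  also have "\<dots> = avg (V \<rightarrow>\<^sub>E labels q) (\<lambda>l. (- 1 / (real q)\<^sup>2) * edge_bias l {v, w})"
  proof (rule avg_cong)
    fix l assume "l \<in> V \<rightarrow>\<^sub>E labels q"
    then have "l v \<in> labels q" using assms by auto
    then show "avg (labels q) (\<lambda>x. edge_bias (l(u := x)) {u, v} * edge_bias l {v, w}) =
      (- 1 / (real q)\<^sup>2) * edge_bias l {v, w}"
      using avg_edge_bias[OF assms(5)] by (simp only: avg_multc)
  qed
  also have "\<dots> = (- 1 / (real q)\<^sup>2) * mean_bias V q {{v, w}}"
    by (simp only: avg_cmult mean_bias_def) simp
  finally show ?thesis
    using assms by (simp add: mean_bias_edge power_numeral_reduce)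
qed

text \<open>The label of \<open>u\<close> is averaged first, then that of \<open>v\<close>. The
  terms of order \<open>q^-2\<close> coming from rows and from columns cancel, which brings the bias
  down to order \<open>q^-3\<close>.\<close>

lemma mean_bias_triangle:
  assumes "finite V" "u \<in> V" "v \<in> V" "w \<in> V" "u \<noteq> v" "u \<noteq> w" "v \<noteq> w" "q > 0"
  shows "mean_bias V q {{u, v}, {u, w}, {v, w}} = - 6 / real q ^ 3 + 5 / real q ^ 4"
proof -
  have L: "finite (labels q)" "labels q \<noteq> {}" using assms by auto
  have ne: "{u, v} \<noteq> {v, w}" "{u, v} \<noteq> {u, w}" "{u, w} \<noteq> {v, w}"
    using assms by (auto simp: doubleton_eq_iff)
  have b: "edge_bias (l(u := x)) {v, w} = edge_bias l {v, w}" for l :: "'a \<Rightarrow> nat \<times> nat" and x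
    using assms by (intro edge_bias_cong) auto
  let ?R = "\<lambda>l :: 'a \<Rightarrow> nat \<times> nat. of_bool (fst (l v) = fst (l w)) :: real"
  let ?C = "\<lambda>l :: 'a \<Rightarrow> nat \<times> nat. of_bool (snd (l v) = snd (l w)) :: real"
  define i where "i = 1 / real q"
  have "mean_bias V q {{u, v}, {u, w}, {v, w}} =
    avg (V \<rightarrow>\<^sub>E labels q) (\<lambda>l. avg (labels q) (\<lambda>x.
      (edge_bias (l(u := x)) {u, v} * edge_bias (l(u := x)) {u, w}) * edge_bias l {v, w}))"
    unfolding mean_bias_def
    by (subst avg_PiE_resample[OF assms(1,2) L]) (simp add: ne b mult.assoc)
  \<comment> \<open>The bias of \<open>{v, w}\<close> is zero when neither row nor column agrees.
    The coefficients are fixed by the three remaining cases: only the row, only the column, or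
    both.\<close>
  also have "\<dots> = avg (V \<rightarrow>\<^sub>E labels q) (\<lambda>l. (- i) * ?R l + (i - 4 * i\<^sup>2) * ?C l
      + (5 * i\<^sup>2 - 2 * i) * (?R l * ?C l))"
  proof (rule avg_cong)
    fix l assume "l \<in> V \<rightarrow>\<^sub>E labels q"
    then have "l v \<in> labels q" "l w \<in> labels q" using assms by auto
    note * = avg_edge_bias_mult[OF assms(5,6) this]
    show "avg (labels q) (\<lambda>x. (edge_bias (l(u := x)) {u, v} * edge_bias (l(u := x)) {u, w})
        * edge_bias l {v, w}) = (- i) * ?R l + (i - 4 * i\<^sup>2) * ?C l + (5 * i\<^sup>2 - 2 * i) * (?R l * ?C l)"
      unfolding avg_multc * edge_bias_pair[of l v w] i_def
      by (cases "fst (l v) = fst (l w)"; cases "snd (l v) = snd (l w)")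
        (simp_all add: field_simps power2_eq_square)
  qed
  also have "\<dots> = avg (V \<rightarrow>\<^sub>E labels q) (\<lambda>l. avg (labels q) (\<lambda>x.
      (- i) * of_bool (fst x = fst (l w)) + (i - 4 * i\<^sup>2) * of_bool (snd x = snd (l w))
      + (5 * i\<^sup>2 - 2 * i) * (of_bool (fst x = fst (l w)) * of_bool (snd x = snd (l w)))))"
    using assms by (subst avg_PiE_resample[OF assms(1,3) L]) simp
  also have "\<dots> = avg (V \<rightarrow>\<^sub>E labels q) (\<lambda>l. (- i) * i + (i - 4 * i\<^sup>2) * i + (5 * i\<^sup>2 - 2 * i) * (i * i))"
  proof (rule avg_cong)
    fix l assume "l \<in> V \<rightarrow>\<^sub>E labels q"
    then have "l w \<in> labels q" using assms by auto
    then have w: "fst (l w) \<in> {1..q}" "snd (l w) \<in> {1..q}" by auto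
    show "avg (labels q) (\<lambda>x. (- i) * of_bool (fst x = fst (l w)) +
        (i - 4 * i\<^sup>2) * of_bool (snd x = snd (l w))
      + (5 * i\<^sup>2 - 2 * i) * (of_bool (fst x = fst (l w)) * of_bool (snd x = snd (l w)))) =
      (- i) * i + (i - 4 * i\<^sup>2) * i + (5 * i\<^sup>2 - 2 * i) * (i * i)"
      using w by (simp only: avg_add avg_cmult avg_labels_same i_def)
  qed
  also have "\<dots> = (- i) * i + (i - 4 * i\<^sup>2) * i + (5 * i\<^sup>2 - 2 * i) * (i * i)"
    using assms L by (simp add: avg_const finite_PiE PiE_eq_empty_iff)
  also have "\<dots> = - 6 / real q ^ 3 + 5 / real q ^ 4"
    using \<open>q > 0\<close> by (simp add: i_def field_simps power_numeral_reduce)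
  finally show ?thesis .
qed

section \<open>Spanning-tree bound for connected edge sets\<close>

text \<open>Union bound: the bias is nonzero only if the fresh label shares the row or the column of
  \<open>v\<close>.\<close>

lemma avg_abs_edge_bias_le:
  assumes "u \<noteq> v" "l v \<in> labels q"
  shows "avg (labels q) (\<lambda>x. \<bar>edge_bias (l(u := x)) {u, v}\<bar>) \<le> 2 / real q"
proof -
  obtain r c where l: "l v = (r, c)" "r \<in> {1..q}" "c \<in> {1..q}" using assms(2) by auto
  have "avg (labels q) (\<lambda>x. \<bar>edge_bias (l(u := x)) {u, v}\<bar>) \<le>
    avg (labels q) (\<lambda>x. of_bool (fst x = r) + of_bool (snd x = c))"
  proof (rule avg_mono)
    fix x :: "nat \<times> nat"
    show "\<bar>edge_bias (l(u := x)) {u, v}\<bar> \<le> of_bool (fst x = r) + of_bool (snd x = c)"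
      using assms(1)[symmetric] l(1)
      by (cases "fst x = r"; cases "snd x = c") (simp_all add: edge_bias_pair)
  qed
  also have "\<dots> = 2 / real q"
    using l by (simp only: avg_add avg_labels_same)
  finally show ?thesis .
qed

text \<open>
  Stated through vertex-disjoint splittings rather than walks, so that a disconnected set of edges
  comes with the two smaller sets over which the mean bias factorizes.
\<close>

definition edge_connected :: "'v set set \<Rightarrow> bool" where
  "edge_connected H \<longleftrightarrow>
     (\<forall>S T. H = S \<union> T \<and> \<Union>S \<inter> \<Union>T = {} \<longrightarrow> S = {} \<or> T = {})"

text \<open>Otherwise every edge lies inside \<open>A\<close> or avoids \<open>A\<close>, and these
  two classes split \<open>H\<close> into nonempty vertex-disjoint parts. The crossing edge is the
  one by which a spanning tree is extended.\<close>

lemma edge_connected_grow: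
  assumes H: "edge_connected H" "\<And>e. e \<in> H \<Longrightarrow> card e = 2"
    and A: "A \<subseteq> \<Union>H" "A \<noteq> {}" "A \<noteq> \<Union>H"
  obtains u w where "u \<in> A" "w \<notin> A" "{w, u} \<in> H"
proof -
  have "\<exists>e\<in>H. e \<inter> A \<noteq> {} \<and> \<not> e \<subseteq> A"
  proof (rule ccontr)
    assume "\<not> ?thesis"
    then have *: "e \<inter> A = {} \<or> e \<subseteq> A" if "e \<in> H" for e using that by blast
    define S T where "S = {e \<in> H. e \<subseteq> A}" and "T = {e \<in> H. e \<inter> A = {}}"
    have "H = S \<union> T" "\<Union>S \<inter> \<Union>T = {}" using * unfolding S_def T_def by blast+
    then have "S = {} \<or> T = {}" using H(1) unfolding edge_connected_def by blast
    then show False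
    proof
      assume "S = {}"
      then have "H = T" using \<open>H = S \<union> T\<close> by simp
      then have "\<Union>H \<inter> A = {}" unfolding T_def by blast
      then show False using A by blast
    next
      assume "T = {}"
      then have "H = S" using \<open>H = S \<union> T\<close> by simp
      then have "\<Union>H \<subseteq> A" unfolding S_def by blast
      then show False using A by blast
    qed
  qed
  then obtain e u w where e: "e \<in> H" "u \<in> e" "u \<in> A" "w \<in> e" "w \<notin> A" by blast
  then have "u \<noteq> w" by blast
  have "card e = 2" using H(2) e(1) .
  then have "e = {w, u}" using e \<open>u \<noteq> w\<close> by (auto simp: card_2_iff)
  then show thesis using that e by blast
qed

text \<open>\<open>A\<close> is the vertex set of a growing tree. Each new vertex is joined to
  \<open>A\<close> by an edge, and averaging over the new label alone makes this edge cost a factor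
  \<open>2 / q\<close>; the first vertex costs nothing.\<close>

lemma avg_abs_edge_bias_grow:
  assumes V: "finite V" "q > 0" and H: "finite H" "edge_connected H" "H \<noteq> {}"
    and e: "\<And>e. e \<in> H \<Longrightarrow> e \<subseteq> V \<and> card e = 2"
    and k: "k < card (\<Union>H)"
  shows "\<exists>A\<subseteq>\<Union>H. card A = Suc k \<and>
    avg (V \<rightarrow>\<^sub>E labels q) (\<lambda>l. \<Prod>e\<in>{e \<in> H. e \<subseteq> A}. \<bar>edge_bias l e\<bar>) \<le> (2 / real q) ^ k"
  using k
proof (induction k)
  case 0
  have "\<Union>H \<noteq> {}" using 0 by (metis card.empty less_irrefl)
  then obtain a where "a \<in> \<Union>H" by blast
  have "\<not> e \<subseteq> {a}" if "e \<in> H" for e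
    using e[OF that] by (auto dest!: subset_singletonD)
  then have "{e \<in> H. e \<subseteq> {a}} = {}" by blast
  moreover have "finite (V \<rightarrow>\<^sub>E labels q)" "(V \<rightarrow>\<^sub>E labels q) \<noteq> {}"
    using V by (auto simp: finite_PiE PiE_eq_empty_iff)
  ultimately have
    "avg (V \<rightarrow>\<^sub>E labels q) (\<lambda>l. \<Prod>e\<in>{e \<in> H. e \<subseteq> {a}}. \<bar>edge_bias l e\<bar>) = 1"
    by (simp only: simp_thms prod.empty avg_const)
  then show ?case
    using \<open>a \<in> \<Union>H\<close> by (intro exI[of _ "{a}"]) auto
next
  case (Suc k)
  then obtain A where A: "A \<subseteq> \<Union>H" "card A = Suc k"
    and le: "avg (V \<rightarrow>\<^sub>E labels q) (\<lambda>l. \<Prod>e\<in>{e \<in> H. e \<subseteq> A}. \<bar>edge_bias l e\<bar>) \<le> (2 / real q) ^ k"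
    by auto
  have HV: "\<Union>H \<subseteq> V" using e by blast
  have "finite A" using A(2) card.infinite by fastforce
  have "A \<noteq> {}" "A \<noteq> \<Union>H" using A(2) Suc.prems by auto
  then obtain u w where uw: "u \<in> A" "w \<notin> A" "{w, u} \<in> H"
    using edge_connected_grow[OF H(2) _ A(1)] e by blast
  have "u \<noteq> w" using uw by blast
  let ?g = "\<lambda>l. \<Prod>e\<in>{e \<in> H. e \<subseteq> A}. \<bar>edge_bias l e\<bar>"
  let ?g' = "\<lambda>l. \<Prod>e\<in>{e \<in> H. e \<subseteq> insert w A}. \<bar>edge_bias l e\<bar>"
  have wV: "w \<in> V" and uV: "u \<in> V" using uw HV by blast+
  have L: "finite (labels q)" "labels q \<noteq> {}" using V by auto
  \<comment> \<open>Edges inside \<open>A\<close> avoid \<open>w\<close>, so their product is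
    constant while the label of \<open>w\<close> is averaged.\<close>
  have g_upd: "?g (l(w := x)) = ?g l" for l :: "'a \<Rightarrow> nat \<times> nat" and x
  proof (rule prod.cong[OF refl])
    fix e assume "e \<in> {e \<in> H. e \<subseteq> A}"
    then have "w \<notin> e" using uw by blast
    then have "edge_bias (l(w := x)) e = edge_bias l e"
      by (intro edge_bias_cong) auto
    then show "\<bar>edge_bias (l(w := x)) e\<bar> = \<bar>edge_bias l e\<bar>" by simp
  qed
  \<comment> \<open>Of the edges that \<open>w\<close> brings in, only the tree edge
    \<open>{w, u}\<close> is kept; the others have absolute bias at most 1.\<close>
  have "?g' l \<le> \<bar>edge_bias l {w, u}\<bar> * ?g l" for l :: "'a \<Rightarrow> nat \<times> nat"
  proof -
    let ?E = "insert {w, u} {e \<in> H. e \<subseteq> A}"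
    have sub: "?E \<subseteq> {e \<in> H. e \<subseteq> insert w A}" using uw by auto
    have fin: "finite {e \<in> H. e \<subseteq> insert w A}" using H by simp
    have notin: "{w, u} \<notin> {e \<in> H. e \<subseteq> A}" using uw by simp
    have "?g' l = (\<Prod>e\<in>{e \<in> H. e \<subseteq> insert w A} - ?E. \<bar>edge_bias l e\<bar>) * (\<Prod>e\<in>?E. \<bar>edge_bias l e\<bar>)"
      by (rule prod.subset_diff[OF sub fin])
    also have "\<dots> \<le> 1 * (\<Prod>e\<in>?E. \<bar>edge_bias l e\<bar>)"
      by (intro mult_right_mono prod_le_1 prod_nonneg) (simp_all add: abs_edge_bias_le_1)
    also have "\<dots> = \<bar>edge_bias l {w, u}\<bar> * ?g l"
      using H notin by (subst prod.insert) auto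
    finally show ?thesis .
  qed
  then have "avg (V \<rightarrow>\<^sub>E labels q) ?g' \<le> avg (V \<rightarrow>\<^sub>E labels q) (\<lambda>l. \<bar>edge_bias l {w, u}\<bar> * ?g l)"
    by (rule avg_mono)
  also have "\<dots> = avg (V \<rightarrow>\<^sub>E labels q) (\<lambda>l. avg (labels q) (\<lambda>x. \<bar>edge_bias (l(w := x)) {w, u}\<bar>) * ?g l)"
    by (subst avg_PiE_resample[OF V(1) wV L]) (simp only: g_upd avg_multc)
  also have "\<dots> \<le> avg (V \<rightarrow>\<^sub>E labels q) (\<lambda>l. 2 / real q * ?g l)"
  proof (rule avg_mono)
    fix l assume "l \<in> V \<rightarrow>\<^sub>E labels q"
    then have "l u \<in> labels q" using uV by auto
    then show "avg (labels q) (\<lambda>x. \<bar>edge_bias (l(w := x)) {w, u}\<bar>) * ?g l \<le> 2 / real q * ?g l"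
      using avg_abs_edge_bias_le[of w u l q] \<open>u \<noteq> w\<close>
      by (intro mult_right_mono prod_nonneg) simp_all
  qed
  also have "\<dots> \<le> 2 / real q * (2 / real q) ^ k"
    unfolding avg_cmult by (intro mult_left_mono le) simp
  finally have "avg (V \<rightarrow>\<^sub>E labels q) ?g' \<le> (2 / real q) ^ Suc k" by simp
  moreover have "card (insert w A) = Suc (Suc k)" using A(2) uw \<open>finite A\<close> by simp
  moreover have "insert w A \<subseteq> \<Union>H" using A uw by blast
  ultimately show ?case by blast
qed

text \<open>When the tree has as many vertices as the span of \<open>H\<close>, it is the whole
  span, and every edge of \<open>H\<close> has been collected.\<close>

lemma abs_mean_bias_le_connected:
  assumes V: "finite V" "q > 0" and H: "finite H" "edge_connected H" "H \<noteq> {}"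
    and e: "\<And>e. e \<in> H \<Longrightarrow> e \<subseteq> V \<and> card e = 2"
  shows "\<bar>mean_bias V q H\<bar> \<le> (2 / real q) ^ (card (\<Union>H) - 1)"
proof -
  have "\<Union>H \<subseteq> V" using e by blast
  then have fin: "finite (\<Union>H)" using V finite_subset by blast
  have "\<Union>H \<noteq> {}" using H(3) e by fastforce
  then have "card (\<Union>H) - 1 < card (\<Union>H)" using fin by (simp add: card_gt_0_iff)
  from avg_abs_edge_bias_grow[OF V H e this] obtain A where A: "A \<subseteq> \<Union>H"
    "card A = Suc (card (\<Union>H) - 1)"
    and le: "avg (V \<rightarrow>\<^sub>E labels q) (\<lambda>l. \<Prod>e\<in>{e \<in> H. e \<subseteq> A}. \<bar>edge_bias l e\<bar>) \<le> (2 / real q) ^ (card (\<Union>H) - 1)"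
    by blast
  have "A = \<Union>H" using A fin \<open>\<Union>H \<noteq> {}\<close> by (intro card_subset_eq) (auto simp: card_gt_0_iff)
  then have "{e \<in> H. e \<subseteq> A} = H" by blast
  then have "avg (V \<rightarrow>\<^sub>E labels q) (\<lambda>l. \<bar>\<Prod>e\<in>H. edge_bias l e\<bar>) \<le> (2 / real q) ^ (card (\<Union>H) - 1)"
    using le by (simp add: abs_prod)
  then show ?thesis unfolding mean_bias_def by (rule order_trans[OF abs_avg_le])
qed

section \<open>Bounds exponential in the number of spanned vertices\<close>

text \<open>For \<open>v\<close> spanned vertices the tree bound has exponent \<open>v - 1\<close>,
  which is at least \<open>3 * v / 4\<close> exactly when \<open>v \<ge> 4\<close>. For
  \<open>v = 2\<close> and \<open>v = 3\<close> it is too weak, and the exact values for the edge,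
  the path and the triangle take over.\<close>

lemma abs_mean_bias_le_connected_powr:
  assumes V: "finite V" "q > 0" and H: "finite H" "edge_connected H" "H \<noteq> {}"
    and e: "\<And>e. e \<in> H \<Longrightarrow> e \<subseteq> V \<and> card e = 2"
  shows "\<bar>mean_bias V q H\<bar> \<le> (2 * real q powr (- 3 / 4)) ^ card (\<Union>H)"
proof -
  define p where "p = real q powr (- 3 / 4)"
  define v where "v = card (\<Union>H)"
  have q1: "real q \<ge> 1" using V by simp
  have p: "p > 0" using V by (simp add: p_def)
  have "1 / real q = real q powr (- 1)" using V by (simp add: powr_minus divide_inverse)
  also have "\<dots> \<le> p" unfolding p_def using q1 by (intro powr_mono) auto
  finally have qp: "1 / real q \<le> p" .
  have qpow: "1 / real q ^ k \<le> p ^ k" for k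
    using power_mono[OF qp, of k] by (simp add: power_divide)
  have "\<Union>H \<subseteq> V" using e by blast
  then have fin: "finite (\<Union>H)" using V finite_subset by blast
  obtain e0 where e0: "e0 \<in> H" using H by blast
  have "card e0 \<le> v" unfolding v_def using fin e0 by (intro card_mono) auto
  then have "v \<ge> 2" using e e0 by auto
  then consider "v = 2" | "v = 3" | "v \<ge> 4" by linarith
  then have "\<bar>mean_bias V q H\<bar> \<le> (2 * p) ^ v"
  proof cases
    case 1
    have "e = \<Union>H" if "e \<in> H" for e
      using that e 1 fin by (intro card_subset_eq) (auto simp: v_def)
    then have "H = {\<Union>H}" using H(3) by blast
    moreover obtain a b where "\<Union>H = {a, b}" "a \<noteq> b"
      using 1 unfolding v_def by (auto simp: card_2_iff)
    ultimately have "mean_bias V q H = - 1 / (real q)\<^sup>2"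
      using mean_bias_edge[OF V(1), of a b q] \<open>\<Union>H \<subseteq> V\<close> V(2) by (metis insert_subset)
    then have "\<bar>mean_bias V q H\<bar> = 1 / real q ^ 2" by simp
    also have "\<dots> \<le> p ^ 2" by (rule qpow)
    also have "\<dots> \<le> (2 * p) ^ 2" using p by (intro power_mono) auto
    finally show ?thesis using 1 by simp
  next
    case 2
    obtain a b c where abc: "\<Union>H = {a, b, c}" "a \<noteq> b" "a \<noteq> c" "b \<noteq> c"
      using 2 unfolding v_def by (auto simp: card_3_iff)
    have inV: "a \<in> V" "b \<in> V" "c \<in> V" using abc \<open>\<Union>H \<subseteq> V\<close> by auto
    have *: "e \<in> {{a, b}, {a, c}, {b, c}}" if "e \<in> H" for e
    proof -
      have "e \<subseteq> {a, b, c}" "card e = 2" using that e abc by auto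
      then show ?thesis by (auto simp: card_2_iff doubleton_eq_iff)
    qed
    \<comment> \<open>Each vertex lies on two of the three possible edges and is covered by
      \<open>H\<close>, so at most one edge is missing. In the paths the middle vertex is written in
      the inner positions, as in \<open>mean_bias_path\<close>.\<close>
    have "H = {{a, b}, {a, c}, {b, c}} \<or> H = {{a, b}, {b, c}} \<or> H = {{b, a}, {a, c}} \<or> H = {{a, c}, {c, b}}"
    proof -
      have ab: "{a, b} \<notin> H \<Longrightarrow> {a, c} \<in> H \<and> {b, c} \<in> H"
        and ac: "{a, c} \<notin> H \<Longrightarrow> {a, b} \<in> H \<and> {b, c} \<in> H"
        and bc: "{b, c} \<notin> H \<Longrightarrow> {a, b} \<in> H \<and> {a, c} \<in> H"
      proof -
        have a: "a \<in> \<Union>H" and b: "b \<in> \<Union>H" and c: "c \<in> \<Union>H" using abc by auto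
        have "{a, b} \<in> H \<or> {a, c} \<in> H" using a * abc by (metis UnionE insertE singletonD)
        moreover have "{a, b} \<in> H \<or> {b, c} \<in> H" using b * abc by (metis UnionE insertE singletonD)
        moreover have "{a, c} \<in> H \<or> {b, c} \<in> H" using c * abc by (metis UnionE insertE singletonD)
        ultimately show "{a, b} \<notin> H \<Longrightarrow> {a, c} \<in> H \<and> {b, c} \<in> H"
          "{a, c} \<notin> H \<Longrightarrow> {a, b} \<in> H \<and> {b, c} \<in> H"
          "{b, c} \<notin> H \<Longrightarrow> {a, b} \<in> H \<and> {a, c} \<in> H" by blast+
      qed
      have sub: "H \<subseteq> {{a, b}, {a, c}, {b, c}}" using * by blast
      have comm: "{b, a} = {a, b}" "{c, b} = {b, c}" by blast+
      have "H = {x, y, z} \<or> H = {x, z} \<or> H = {x, y} \<or> H = {y, z}"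
        if "H \<subseteq> {x, y, z}" "x \<notin> H \<Longrightarrow> y \<in> H \<and> z \<in> H" "y \<notin> H \<Longrightarrow> x \<in> H \<and> z \<in> H"
          "z \<notin> H \<Longrightarrow> x \<in> H \<and> y \<in> H" for x y z
        using that by (cases "x \<in> H"; cases "y \<in> H"; cases "z \<in> H") auto
      from this[OF sub ab ac bc] show ?thesis
        unfolding comm by assumption
    qed
    then have "\<bar>mean_bias V q H\<bar> \<le> 6 / real q ^ 3"
    proof (elim disjE)
      assume "H = {{a, b}, {a, c}, {b, c}}"
      then have eq: "mean_bias V q H = - 6 / real q ^ 3 + 5 / real q ^ 4"
        using mean_bias_triangle[OF V(1) inV abc(2-4) V(2)] by simp
      have "5 / real q ^ 4 \<le> 5 / real q ^ 3"
        using q1 by (intro divide_left_mono power_increasing mult_pos_pos zero_less_power) auto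
      also have "\<dots> \<le> 6 / real q ^ 3" by (intro divide_right_mono) auto
      finally show ?thesis unfolding eq by simp
    next
      have "1 / real q ^ 4 \<le> 6 / real q ^ 3"
        using q1 by (intro frac_le power_increasing) auto
      then have path: "\<bar>mean_bias V q {{x, y}, {y, z}}\<bar> \<le> 6 / real q ^ 3"
        if "x \<in> V" "y \<in> V" "z \<in> V" "x \<noteq> y" "x \<noteq> z" "y \<noteq> z" for x y z
        using mean_bias_path[OF V(1) that V(2)] by simp
      {
        assume "H = {{a, b}, {b, c}}"
        then show ?thesis using path inV abc by metis
      next
        assume "H = {{b, a}, {a, c}}"
        then show ?thesis using path inV abc by metis
      next
        assume "H = {{a, c}, {c, b}}"
        then show ?thesis using path inV abc by metis
      }
    qed
    also have "\<dots> \<le> 6 * p ^ 3" using qpow[of 3] by simp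
    \<comment> \<open>The factor 2 in the bound pays for the constant:
      \<open>6 \<le> 2 ^ 3\<close>.\<close>
    also have "\<dots> \<le> (2 * p) ^ 3" using p by (simp add: power_mult_distrib)
    finally show ?thesis using 2 by simp
  next
    case 3
    have "\<bar>mean_bias V q H\<bar> \<le> (2 / real q) ^ (v - 1)"
      unfolding v_def by (rule abs_mean_bias_le_connected[OF assms])
    also have "\<dots> = 2 ^ (v - 1) * real q powr (- real (v - 1))"
      using q1 by (simp add: powr_minus powr_realpow divide_inverse power_mult_distrib power_inverse)
    also have "\<dots> \<le> 2 ^ v * real q powr (real v * (- 3 / 4))"
      using q1 3 by (intro mult_mono power_increasing powr_mono) (auto simp: of_nat_diff)
    also have "\<dots> = (2 * p) ^ v"
      using q1 by (simp add: p_def power_mult_distrib powr_power mult.commute)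
    finally show ?thesis .
  qed
  then show ?thesis by (simp add: p_def v_def)
qed

text \<open>Induction over proper subsets: a disconnected set splits into vertex-disjoint parts,
  over which biases multiply while vertex counts add.\<close>

lemma abs_mean_bias_le:
  assumes V: "finite V" "q > 0" and "finite S" and "\<And>e. e \<in> S \<Longrightarrow> e \<subseteq> V \<and> card e = 2"
  shows "\<bar>mean_bias V q S\<bar> \<le> (2 * real q powr (- 3 / 4)) ^ card (\<Union>S)"
  using assms(3,4)
proof (induction S rule: finite_psubset_induct)
  case (psubset S)
  show ?case
  proof (cases "S = {}")
    case True
    have "finite (V \<rightarrow>\<^sub>E labels q)" "(V \<rightarrow>\<^sub>E labels q) \<noteq> {}"
      using V by (auto simp: finite_PiE PiE_eq_empty_iff)
    then show ?thesis using True by (simp add: mean_bias_def avg_const)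
  next
    case nonempty: False
    show ?thesis
    proof (cases "edge_connected S")
      case True
      then show ?thesis
        using abs_mean_bias_le_connected_powr[OF V psubset.hyps(1) True nonempty] psubset.prems by blast
    next
      case False
      then obtain A B where AB: "S = A \<union> B" "\<Union>A \<inter> \<Union>B = {}" "A \<noteq> {}" "B \<noteq> {}"
        unfolding edge_connected_def by blast
      have fin: "finite A" "finite B" using psubset.hyps AB by auto
      have ne: "e \<noteq> {}" if "e \<in> S" for e using psubset.prems[OF that] by auto
      have disj: "A \<inter> B = {}"
      proof (rule ccontr)
        assume "A \<inter> B \<noteq> {}"
        then obtain e where "e \<in> A" "e \<in> B" by blast
        then show False using ne[of e] AB by blast
      qed
      have SV: "\<Union>S \<subseteq> V" using psubset.prems by blast
      then have finU: "finite (\<Union>A)" "finite (\<Union>B)"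
        using V AB(1) by (auto intro: finite_subset)
      have "A \<subset> S" "B \<subset> S" using AB disj by blast+
      then have IH: "\<bar>mean_bias V q A\<bar> \<le> (2 * real q powr (- 3 / 4)) ^ card (\<Union>A)"
        "\<bar>mean_bias V q B\<bar> \<le> (2 * real q powr (- 3 / 4)) ^ card (\<Union>B)"
        using psubset.IH[OF \<open>A \<subset> S\<close>] psubset.IH[OF \<open>B \<subset> S\<close>] psubset.prems AB(1) by blast+
      have "\<bar>mean_bias V q S\<bar> = \<bar>mean_bias V q A\<bar> * \<bar>mean_bias V q B\<bar>"
        using SV by (simp only: AB(1) Union_Un_distrib Un_subset_iff mean_bias_Un[OF V fin _ AB(2) disj] abs_mult)
      also have "\<dots> \<le> (2 * real q powr (- 3 / 4)) ^ card (\<Union>A) * (2 * real q powr (- 3 / 4)) ^ card (\<Union>B)"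
        by (intro mult_mono IH) auto
      also have "\<dots> = (2 * real q powr (- 3 / 4)) ^ card (\<Union>S)"
        using finU AB by (simp add: card_Un_disjoint power_add Union_Un_distrib)
      finally show ?thesis .
    qed
  qed
qed

section \<open>Fourier analysis on graphs\<close>

lemma avg_graphs_prod:
  "avg (graphs n) (\<lambda>X. \<Prod>e\<in>pairs n. g e (X e)) = (\<Prod>e\<in>pairs n. (g e 1 + g e (- 1)) / 2)"
proof -
  have "(\<Sum>X\<in>graphs n. \<Prod>e\<in>pairs n. g e (X e)) = (\<Prod>e\<in>pairs n. \<Sum>x\<in>{- 1, 1}. g e x)"
    unfolding graphs_def by (rule prod_sum_PiE[symmetric]) (simp_all add: finite_pairs)
  also have "\<dots> = (\<Prod>e\<in>pairs n. g e 1 + g e (- 1))"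
    by (simp add: add.commute)
  finally show ?thesis
    by (simp add: avg_def graphs_def card_PiE finite_pairs prod_dividef power_divide)
qed

lemma avg_graphs_prod_mult:
  assumes "S \<subseteq> pairs n"
  shows "avg (graphs n) (\<lambda>X. (\<Prod>e\<in>pairs n. g e (X e)) * (\<Prod>e\<in>S. X e)) =
    (\<Prod>e\<in>pairs n. (if e \<in> S then g e 1 - g e (- 1) else g e 1 + g e (- 1)) / 2)"
proof -
  have eq: "(\<Prod>e\<in>S. X e) = (\<Prod>e\<in>pairs n. if e \<in> S then X e else 1)" for X :: sgraph
    using assms by (subst prod.inter_restrict[symmetric]) (simp_all add: finite_pairs Int_absorb1)
  have "avg (graphs n) (\<lambda>X. (\<Prod>e\<in>pairs n. g e (X e)) * (\<Prod>e\<in>S. X e)) =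
    avg (graphs n) (\<lambda>X. \<Prod>e\<in>pairs n. g e (X e) * (if e \<in> S then X e else 1))"
    unfolding eq by (simp only: prod.distrib)
  also have "\<dots> = (\<Prod>e\<in>pairs n. (if e \<in> S then g e 1 - g e (- 1) else g e 1 + g e (- 1)) / 2)"
    by (subst avg_graphs_prod) (rule prod.cong, auto)
  finally show ?thesis .
qed

text \<open>If all \<open>w e\<close> lie between -1 and 1, the first product is the density,
  relative to uniform graphs, of independent edge variables with means \<open>w e\<close>.\<close>

lemma avg_graphs_tilted:
  assumes "S \<subseteq> pairs n"
  shows "avg (graphs n) (\<lambda>X. (\<Prod>e\<in>pairs n. 1 + w e * X e) * (\<Prod>e\<in>S. X e)) = (\<Prod>e\<in>S. w e)"
proof -
  have "avg (graphs n) (\<lambda>X. (\<Prod>e\<in>pairs n. 1 + w e * X e) * (\<Prod>e\<in>S. X e)) =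
    (\<Prod>e\<in>pairs n. if e \<in> S then w e else 1)"
    by (subst avg_graphs_prod_mult[OF assms, where g = "\<lambda>e x. 1 + w e * x"]) (rule prod.cong, auto)
  also have "\<dots> = (\<Prod>e\<in>S. w e)"
    using assms by (subst prod.inter_restrict[symmetric]) (simp_all add: finite_pairs Int_absorb1)
  finally show ?thesis .
qed

text \<open>The average factors over edges: an edge in exactly one of the two sets contributes 0,
  every other edge contributes 1.\<close>

lemma avg_graphs_orthogonal:
  assumes "S \<subseteq> pairs n" "T \<subseteq> pairs n"
  shows "avg (graphs n) (\<lambda>X. (\<Prod>e\<in>S. X e) * (\<Prod>e\<in>T. X e)) = of_bool (S = T)"
proof -
  have eq: "(\<Prod>e\<in>S. X e) = (\<Prod>e\<in>pairs n. if e \<in> S then X e else 1)" for X :: sgraph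
    using assms by (subst prod.inter_restrict[symmetric]) (simp_all add: finite_pairs Int_absorb1)
  have "avg (graphs n) (\<lambda>X. (\<Prod>e\<in>S. X e) * (\<Prod>e\<in>T. X e)) =
    (\<Prod>e\<in>pairs n. of_bool (e \<in> S \<longleftrightarrow> e \<in> T))"
    unfolding eq
    by (subst avg_graphs_prod_mult[OF assms(2), where g = "\<lambda>e x. if e \<in> S then x else 1"])
      (rule prod.cong, auto)
  also have "\<dots> = of_bool (S = T)"
  proof (cases "S = T")
    case False
    then obtain e where "e \<in> pairs n" "(e \<in> S) \<noteq> (e \<in> T)" using assms by blast
    then show ?thesis
      using False by (auto simp: finite_pairs intro!: prod_zero)
  qed simp
  finally show ?thesis .
qed

section \<open>Multilinear form of polynomials on graphs\<close>

lemma monomial_eval: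
  assumes "X \<in> graphs n" "Poly_Mapping.keys m \<subseteq> pairs n"
  shows "(\<Prod>e\<in>Poly_Mapping.keys m. X e ^ Poly_Mapping.lookup m e) =
    (\<Prod>e\<in>{e \<in> Poly_Mapping.keys m. odd (Poly_Mapping.lookup m e)}. X e)"
proof -
  have "X e ^ k = (if odd k then X e else 1)" if "e \<in> Poly_Mapping.keys m" for e k
  proof -
    have "X e \<in> {- 1, 1}"
      using that assms unfolding graphs_def by blast
    then show ?thesis by auto
  qed
  then have "(\<Prod>e\<in>Poly_Mapping.keys m. X e ^ Poly_Mapping.lookup m e) =
    (\<Prod>e\<in>Poly_Mapping.keys m. if odd (Poly_Mapping.lookup m e) then X e else 1)"
    by (rule prod.cong[OF refl])
  also have "\<dots> = (\<Prod>e\<in>{e \<in> Poly_Mapping.keys m. odd (Poly_Mapping.lookup m e)}. X e)"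
    by (rule prod.inter_filter[symmetric]) simp
  finally show ?thesis .
qed

lemma card_odd_exponents_le:
  "card {e \<in> Poly_Mapping.keys m. odd (Poly_Mapping.lookup m e)} \<le> monom_degree m"
proof -
  have "card {e \<in> Poly_Mapping.keys m. odd (Poly_Mapping.lookup m e)} \<le> (\<Sum>e\<in>Poly_Mapping.keys m. 1)"
    by (simp add: card_mono)
  also have "\<dots> \<le> monom_degree m"
    unfolding monom_degree_def
    by (rule sum_mono) (metis One_nat_def Suc_leI bot_nat_0.not_eq_extremum in_keys_iff)
  finally show ?thesis .
qed

text \<open>Reducing exponents modulo 2 does not change a monomial on values 1 and -1 and does not
  raise its degree. The coefficient of \<open>S\<close> collects all monomials whose odd exponents
  sit exactly on \<open>S\<close>.\<close>

lemma poly_eval_multilinear: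
  assumes "poly_vars p \<subseteq> pairs n" "total_degree p \<le> d"
  shows "\<exists>c. \<forall>X\<in>graphs n.
    poly_eval p X = (\<Sum>S\<in>{S. S \<subseteq> pairs n \<and> card S \<le> d}. c S * (\<Prod>e\<in>S. X e))"
proof (intro exI ballI)
  define c where "c S = (\<Sum>m\<in>{m \<in> Poly_Mapping.keys p.
    {e \<in> Poly_Mapping.keys m. odd (Poly_Mapping.lookup m e)} = S}. Poly_Mapping.lookup p m)" for S
  fix X assume X: "X \<in> graphs n"
  let ?odd = "\<lambda>m. {e \<in> Poly_Mapping.keys m. odd (Poly_Mapping.lookup m e)}"
  let ?F = "{S. S \<subseteq> pairs n \<and> card S \<le> d}"
  have keys: "Poly_Mapping.keys m \<subseteq> pairs n" if "m \<in> Poly_Mapping.keys p" for m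
    using assms(1) that unfolding poly_vars_def by blast
  have deg: "monom_degree m \<le> d" if "m \<in> Poly_Mapping.keys p" for m
    using assms(2) that unfolding total_degree_def by (subst (asm) Max_le_iff) auto
  have "?odd m \<in> ?F" if "m \<in> Poly_Mapping.keys p" for m
    using keys[OF that] deg[OF that] card_odd_exponents_le[of m] by auto
  then have img: "?odd ` Poly_Mapping.keys p \<subseteq> ?F" by blast
  have fin: "finite ?F" using finite_pairs by simp
  have "poly_eval p X = (\<Sum>m\<in>Poly_Mapping.keys p. Poly_Mapping.lookup p m * (\<Prod>e\<in>?odd m. X e))"
    unfolding poly_eval_def by (rule sum.cong) (simp_all add: monomial_eval[OF X keys])
  also have "\<dots> = (\<Sum>S\<in>?F. \<Sum>m\<in>{m \<in> Poly_Mapping.keys p. ?odd m = S}.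
      Poly_Mapping.lookup p m * (\<Prod>e\<in>?odd m. X e))"
    by (rule sum.group[OF _ fin img, symmetric]) simp
  also have "\<dots> = (\<Sum>S\<in>?F. c S * (\<Prod>e\<in>S. X e))"
    by (rule sum.cong[OF refl]) (simp add: c_def sum_distrib_right)
  finally show "poly_eval p X = (\<Sum>S\<in>?F. c S * (\<Prod>e\<in>S. X e))" .
qed

section \<open>The planted likelihood ratio\<close>

text \<open>An edge between two vertices of the same row has bias -1 and value 1, so its factor is
  0. A nonzero product therefore makes the rows a proper coloring.\<close>

lemma colorable_if_tilt_nonzero:
  assumes X: "X \<in> graphs n" and l: "l \<in> {1..n} \<rightarrow>\<^sub>E labels q"
    and nz: "(\<Prod>e\<in>pairs n. 1 + edge_bias l e * X e) \<noteq> 0"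
  shows "X \<in> colorable n q"
proof -
  have lq: "fst (l u) \<in> {1..q}" if "u \<in> {1..n}" for u
  proof -
    have "l u \<in> labels q" using l that by blast
    then show ?thesis by (auto simp: mem_Times_iff)
  qed
  have "fst (l u) \<noteq> fst (l v)" if uv: "u \<in> {1..n}" "v \<in> {1..n}" "u \<noteq> v" "X {u, v} = 1" for u v
  proof
    assume "fst (l u) = fst (l v)"
    then have "1 + edge_bias l {u, v} * X {u, v} = 0" using uv by (simp add: edge_bias_pair)
    moreover have "{u, v} \<in> pairs n" using uv by (simp add: pairs_def)
    ultimately have "(\<Prod>e\<in>pairs n. 1 + edge_bias l e * X e) = 0"
      using finite_pairs by (intro prod_zero) auto
    with nz show False by simp
  qed
  then show ?thesis
    unfolding colorable_def using X lq
    by (intro CollectI conjI exI[of _ "\<lambda>u. fst (l u)"]) auto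
qed

text \<open>The likelihood ratio \<open>L\<close> is nonnegative, has mean 1 and vanishes off the
  colorable graphs, so \<open>L\<close> times the polynomial has mean at least 1. On the Fourier
  side this mean pairs the coefficients \<open>c S\<close> with the mean biases; Cauchy-Schwarz and
  Parseval give the right-hand side. The empty set drops out because the polynomial has mean
  zero.\<close>

lemma separation_lower_bound:
  assumes p: "poly_vars p \<subseteq> pairs n" "total_degree p \<le> d" and "q > 0"
    and ge: "\<And>X. X \<in> colorable n q \<Longrightarrow> poly_eval p X \<ge> 1"
    and zero: "avg (graphs n) (poly_eval p) = 0"
  shows "1 \<le> avg (graphs n) (\<lambda>X. (poly_eval p X)\<^sup>2) *
    (\<Sum>S\<in>{S. S \<subseteq> pairs n \<and> card S \<le> d} - {{}}. (mean_bias {1..n} q S)\<^sup>2)"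
proof -
  let ?F = "{S. S \<subseteq> pairs n \<and> card S \<le> d}"
  let ?\<Lambda> = "{1..n} \<rightarrow>\<^sub>E labels q"
  obtain c where c: "\<And>X. X \<in> graphs n \<Longrightarrow> poly_eval p X = (\<Sum>S\<in>?F. c S * (\<Prod>e\<in>S. X e))"
    using poly_eval_multilinear[OF p] by blast
  have finF: "finite ?F" using finite_pairs by simp
  have emptyF: "{} \<in> ?F" by simp
  have avg_c: "avg (graphs n) (\<lambda>X. poly_eval p X * (\<Prod>e\<in>T. X e)) = c T" if "T \<in> ?F" for T
  proof -
    have "avg (graphs n) (\<lambda>X. poly_eval p X * (\<Prod>e\<in>T. X e)) =
      avg (graphs n) (\<lambda>X. \<Sum>S\<in>?F. c S * ((\<Prod>e\<in>S. X e) * (\<Prod>e\<in>T. X e)))"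
      by (rule avg_cong) (simp add: c sum_distrib_right mult.assoc)
    also have "\<dots> = (\<Sum>S\<in>?F. c S * of_bool (S = T))"
      using that by (simp add: avg_sum avg_cmult avg_graphs_orthogonal)
    also have "\<dots> = c T" using that finF by (simp add: of_bool_def if_distrib cong: if_cong)
    finally show ?thesis .
  qed
  have c0: "c {} = 0" using avg_c[OF emptyF] zero by simp
  have parseval: "avg (graphs n) (\<lambda>X. (poly_eval p X)\<^sup>2) = (\<Sum>S\<in>?F. (c S)\<^sup>2)"
  proof -
    have "avg (graphs n) (\<lambda>X. (poly_eval p X)\<^sup>2) =
      avg (graphs n) (\<lambda>X. \<Sum>S\<in>?F. c S * (poly_eval p X * (\<Prod>e\<in>S. X e)))"
      by (rule avg_cong) (simp add: c power2_eq_square sum_distrib_left ac_simps)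
    also have "\<dots> = (\<Sum>S\<in>?F. (c S)\<^sup>2)"
      unfolding avg_sum avg_cmult by (rule sum.cong) (simp_all add: avg_c power2_eq_square)
    finally show ?thesis .
  qed
  \<comment> \<open>the likelihood ratio of the planted distribution to \<open>G(n, 1/2)\<close>\<close>
  define L where "L X = avg ?\<Lambda> (\<lambda>l. \<Prod>e\<in>pairs n. 1 + edge_bias l e * X e)" for X
  \<comment> \<open>Exchanging the averages over graphs and labels turns the Fourier coefficients of
    \<open>L\<close> into mean biases.\<close>
  have L_avg: "avg (graphs n) (\<lambda>X. L X * (\<Prod>e\<in>S. X e)) = mean_bias {1..n} q S"
    if "S \<subseteq> pairs n" for S
  proof -
    have "avg (graphs n) (\<lambda>X. L X * (\<Prod>e\<in>S. X e)) =
      avg ?\<Lambda> (\<lambda>l. avg (graphs n) (\<lambda>X. (\<Prod>e\<in>pairs n. 1 + edge_bias l e * X e) * (\<Prod>e\<in>S. X e)))"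
      unfolding L_def avg_multc[symmetric] by (rule avg_swap)
    then show ?thesis by (simp only: avg_graphs_tilted[OF that] mean_bias_def)
  qed
  have L_nonneg: "L X \<ge> 0" if "X \<in> graphs n" for X
    unfolding L_def
  proof (intro avg_nonneg prod_nonneg)
    fix l e assume "e \<in> pairs n"
    then have "X e \<in> {- 1, 1}" using that unfolding graphs_def by blast
    then show "0 \<le> 1 + edge_bias l e * X e"
      using abs_edge_bias_le_1[of l e] by auto
  qed
  have L_zero: "L X = 0" if "X \<in> graphs n" "X \<notin> colorable n q" for X
  proof -
    have "(\<Prod>e\<in>pairs n. 1 + edge_bias l e * X e) = 0" if "l \<in> ?\<Lambda>" for l
      using colorable_if_tilt_nonzero[OF \<open>X \<in> graphs n\<close> that] \<open>X \<notin> colorable n q\<close> by blast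
    then show ?thesis unfolding L_def avg_def by simp
  qed
  have "1 = mean_bias {1..n} q {}"
    using \<open>q > 0\<close> by (simp add: mean_bias_def avg_const finite_PiE PiE_eq_empty_iff)
  also have "\<dots> = avg (graphs n) L" using L_avg[of "{}"] by simp
  also have "\<dots> \<le> avg (graphs n) (\<lambda>X. L X * poly_eval p X)"
  proof (rule avg_mono)
    fix X assume X: "X \<in> graphs n"
    show "L X \<le> L X * poly_eval p X"
    proof (cases "X \<in> colorable n q")
      case True
      then show ?thesis using mult_left_mono[OF ge L_nonneg[OF X], of X] by simp
    qed (simp add: L_zero X)
  qed
  also have "\<dots> = avg (graphs n) (\<lambda>X. \<Sum>S\<in>?F. c S * (L X * (\<Prod>e\<in>S. X e)))"
    by (rule avg_cong) (simp add: c sum_distrib_left ac_simps)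
  also have "\<dots> = (\<Sum>S\<in>?F. c S * mean_bias {1..n} q S)"
    unfolding avg_sum avg_cmult by (rule sum.cong) (simp_all add: L_avg)
  also have "\<dots> = (\<Sum>S\<in>?F - {{}}. c S * mean_bias {1..n} q S)"
    by (subst sum.remove[OF finF emptyF]) (simp add: c0)
  finally have "1\<^sup>2 \<le> (\<Sum>S\<in>?F - {{}}. c S * mean_bias {1..n} q S)\<^sup>2"
    by (intro power_mono) auto
  also have "\<dots> \<le> (\<Sum>S\<in>?F - {{}}. (c S)\<^sup>2) * (\<Sum>S\<in>?F - {{}}. (mean_bias {1..n} q S)\<^sup>2)"
    by (rule Cauchy_Schwarz_ineq_sum)
  also have "(\<Sum>S\<in>?F - {{}}. (c S)\<^sup>2) = avg (graphs n) (\<lambda>X. (poly_eval p X)\<^sup>2)"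
    unfolding parseval by (subst sum.remove[OF finF emptyF]) (simp add: c0)
  finally show ?thesis by simp
qed

section \<open>Summing the squared biases\<close>

text \<open>The subsets of size \<open>i\<close> are compared with the \<open>i\<close>-th term of
  the binomial expansion of the right-hand side, whose factor \<open>k choose i\<close> is at least
  1.\<close>

lemma card_subsets_card_le:
  assumes "finite P"
  shows "card {S. S \<subseteq> P \<and> card S \<le> k} \<le> (card P + 1) ^ k"
proof -
  have "{S. S \<subseteq> P \<and> card S \<le> k} = (\<Union>i\<in>{..k}. {S. S \<subseteq> P \<and> card S = i})" by auto
  then have "card {S. S \<subseteq> P \<and> card S \<le> k} \<le> (\<Sum>i\<le>k. card {S. S \<subseteq> P \<and> card S = i})"
    by (simp add: card_UN_le)
  also have "\<dots> = (\<Sum>i\<le>k. card P choose i)"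
    by (simp add: n_subsets[OF assms])
  also have "\<dots> \<le> (\<Sum>i\<le>k. (k choose i) * card P ^ i)"
  proof (rule sum_mono)
    fix i assume "i \<in> {..k}"
    then have "1 \<le> k choose i" by (simp add: Suc_leI)
    moreover have "card P choose i \<le> card P ^ i"
      by (cases "i \<le> card P") (simp_all add: binomial_le_pow binomial_eq_0)
    ultimately show "card P choose i \<le> (k choose i) * card P ^ i"
      using mult_le_mono[of 1 "k choose i"] by simp
  qed
  also have "\<dots> = (card P + 1) ^ k"
    using binomial_ring[of "card P" 1 k] by simp
  finally show ?thesis .
qed

lemma card_edge_sets_spanning_le:
  assumes "finite A"
  shows "real (card {S. S \<subseteq> pairs n \<and> card S \<le> d \<and> \<Union>S = A}) \<le>
    ((1 + 4 * real d ^ 2) powr sqrt (real d)) ^ card A"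
proof (cases "{S. S \<subseteq> pairs n \<and> card S \<le> d \<and> \<Union>S = A} = {}")
  case False
  then obtain S where S: "S \<subseteq> pairs n" "card S \<le> d" "\<Union>S = A" by blast
  let ?a = "card A"
  define P where "P = {e. e \<subseteq> A \<and> card e = 2}"
  have finP: "finite P" using assms unfolding P_def by simp
  \<comment> \<open>At most \<open>d\<close> edges cover at most \<open>2 * d\<close> vertices. This
    replaces \<open>1 + card P\<close> by the base \<open>1 + 4 * d ^ 2\<close>, which is free of
    \<open>card A\<close>.\<close>
  have "?a \<le> (\<Sum>e\<in>S. card e)"
    unfolding S(3)[symmetric] by (rule card_Union_le_sum_card)
  also have "\<dots> = (\<Sum>e\<in>S. 2)" using S(1) by (intro sum.cong) (auto simp: pairs_def)
  also have "\<dots> \<le> 2 * d" using S(2) by simp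
  finally have a: "?a \<le> 2 * d" .
  have N: "card P \<le> ?a ^ 2"
  proof -
    have "card P = ?a choose 2" unfolding P_def by (rule n_subsets[OF assms])
    also have "\<dots> \<le> ?a ^ 2"
      by (cases "2 \<le> ?a") (simp_all add: binomial_le_pow binomial_eq_0)
    finally show ?thesis .
  qed
  \<comment> \<open>\<open>min (v\<^sup>2) d \<le> v * sqrt d\<close> makes the count exponential in \<open>v\<close>\<close>
  define k where "k = min (card P) d"
  have "{S. S \<subseteq> pairs n \<and> card S \<le> d \<and> \<Union>S = A} \<subseteq> {S. S \<subseteq> P \<and> card S \<le> k}"
    using finP unfolding P_def pairs_def k_def by (auto intro!: card_mono)
  then have "card {S. S \<subseteq> pairs n \<and> card S \<le> d \<and> \<Union>S = A} \<le> card {S. S \<subseteq> P \<and> card S \<le> k}"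
    using finP by (intro card_mono) auto
  also have "\<dots> \<le> (card P + 1) ^ k" by (rule card_subsets_card_le[OF finP])
  finally have "real (card {S. S \<subseteq> pairs n \<and> card S \<le> d \<and> \<Union>S = A}) \<le> real ((card P + 1) ^ k)"
    by (simp only: of_nat_le_iff)
  also have "\<dots> = (1 + real (card P)) powr real k"
    by (simp add: powr_realpow add.commute)
  also have "\<dots> \<le> (1 + 4 * real d ^ 2) powr (real ?a * sqrt (real d))"
  proof -
    have "card P \<le> (2 * d) ^ 2" using N power_mono[OF a, of 2] by simp
    then have "real (card P) \<le> real ((2 * d) ^ 2)" by (simp only: of_nat_le_iff)
    then have 1: "1 + real (card P) \<le> 1 + 4 * real d ^ 2" by (simp add: power_mult_distrib)
    have "real k ^ 2 \<le> real (card P) * real d"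
      unfolding k_def power2_eq_square by (intro mult_mono) auto
    also have "\<dots> \<le> real (?a ^ 2) * real d"
      using N by (intro mult_right_mono) (simp_all only: of_nat_le_iff of_nat_0_le_iff)
    also have "\<dots> = (real ?a * sqrt (real d)) ^ 2" by (simp add: power_mult_distrib)
    finally have "real k \<le> real ?a * sqrt (real d)"
      by (rule power2_le_imp_le) simp
    then have "(1 + real (card P)) powr real k \<le> (1 + real (card P)) powr (real ?a * sqrt (real d))"
      by (intro powr_mono) auto
    also have "\<dots> \<le> (1 + 4 * real d ^ 2) powr (real ?a * sqrt (real d))"
      using 1 by (intro powr_mono2) auto
    finally show ?thesis .
  qed
  also have "\<dots> = ((1 + 4 * real d ^ 2) powr sqrt (real d)) ^ ?a"
  proof -
    have "1 + 4 * real d ^ 2 > 0" by (simp add: add_pos_nonneg)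
    then show ?thesis by (simp add: powr_power)
  qed
  finally show ?thesis .
next
  case True
  then show ?thesis by (simp only: card.empty) simp
qed

text \<open>Edge sets are grouped by their span \<open>A\<close>, a nonempty vertex set. With
  \<open>?B\<close> bounding the count per vertex, each group contributes at most
  \<open>(s * ?B) ^ card A\<close>. Over all vertex sets these sum to
  \<open>(1 + s * ?B) ^ n\<close>; the subtracted 1 is the empty span.\<close>

lemma sum_edge_sets_le:
  fixes s :: real
  assumes "s \<ge> 0"
  shows "(\<Sum>S\<in>{S. S \<subseteq> pairs n \<and> card S \<le> d} - {{}}. s ^ card (\<Union>S)) \<le>
    exp (real n * (s * (1 + 4 * real d ^ 2) powr sqrt (real d))) - 1"
proof -
  let ?B = "(1 + 4 * real d ^ 2) powr sqrt (real d)"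
  let ?F = "{S. S \<subseteq> pairs n \<and> card S \<le> d} - {{}}"
  have finF: "finite ?F" using finite_pairs by simp
  have img: "\<Union> ` ?F \<subseteq> Pow {1..n} - {{}}"
  proof
    fix A assume "A \<in> \<Union> ` ?F"
    then obtain S where S: "S \<subseteq> pairs n" "S \<noteq> {}" "A = \<Union>S" by blast
    then obtain e where "e \<in> S" by blast
    then have "e \<noteq> {}" using S(1) by (auto simp: pairs_def)
    then have "A \<noteq> {}" using S(3) \<open>e \<in> S\<close> by blast
    moreover have "A \<subseteq> {1..n}" using S(1) unfolding S(3) pairs_def by blast
    ultimately show "A \<in> Pow {1..n} - {{}}" by blast
  qed
  have "(\<Sum>S\<in>?F. s ^ card (\<Union>S)) =
    (\<Sum>A\<in>Pow {1..n} - {{}}. \<Sum>S\<in>{S \<in> ?F. \<Union>S = A}. s ^ card (\<Union>S))"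
    using finF img by (intro sum.group[symmetric]) auto
  also have "\<dots> \<le> (\<Sum>A\<in>Pow {1..n} - {{}}. (s * ?B) ^ card A)"
  proof (rule sum_mono)
    fix A assume "A \<in> Pow {1..n} - {{}}"
    then have finA: "finite A" using finite_subset by blast
    have "(\<Sum>S\<in>{S \<in> ?F. \<Union>S = A}. s ^ card (\<Union>S)) = real (card {S \<in> ?F. \<Union>S = A}) * s ^ card A"
      by simp
    also have "\<dots> \<le> real (card {S. S \<subseteq> pairs n \<and> card S \<le> d \<and> \<Union>S = A}) * s ^ card A"
      using finite_pairs \<open>s \<ge> 0\<close> by (intro mult_right_mono of_nat_mono card_mono) auto
    also have "\<dots> \<le> ?B ^ card A * s ^ card A"
      using \<open>s \<ge> 0\<close> by (intro mult_right_mono card_edge_sets_spanning_le finA) auto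
    finally show "(\<Sum>S\<in>{S \<in> ?F. \<Union>S = A}. s ^ card (\<Union>S)) \<le> (s * ?B) ^ card A"
      by (simp add: power_mult_distrib mult.commute)
  qed
  also have "\<dots> = (\<Sum>A\<in>Pow {1..n}. (s * ?B) ^ card A) - 1"
    by (subst sum_diff) auto
  also have "(\<Sum>A\<in>Pow {1..n}. (s * ?B) ^ card A) = (1 + s * ?B) ^ n"
    using prod_add[of "{1..n}" "\<lambda>_. s * ?B" "\<lambda>_. 1"] by (simp add: add.commute)
  also have "(1 + s * ?B) ^ n \<le> exp (s * ?B) ^ n"
    using \<open>s \<ge> 0\<close> by (intro power_mono exp_ge_add_one_self) auto
  also have "\<dots> = exp (real n * (s * ?B))" by (simp add: exp_of_nat_mult)
  finally show ?thesis by simp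
qed

lemma sum_mean_bias_le:
  assumes "q > 0"
  shows "(\<Sum>S\<in>{S. S \<subseteq> pairs n \<and> card S \<le> d} - {{}}. (mean_bias {1..n} q S)\<^sup>2) \<le>
    exp (real n * (4 * real q powr (- 3 / 2) * (1 + 4 * real d ^ 2) powr sqrt (real d))) - 1"
proof -
  have s: "(2 * real q powr (- 3 / 4))\<^sup>2 = 4 * real q powr (- 3 / 2)"
    using assms by (simp add: power_mult_distrib powr_power)
  have "(mean_bias {1..n} q S)\<^sup>2 \<le> (4 * real q powr (- 3 / 2)) ^ card (\<Union>S)" if "S \<subseteq> pairs n" for S
  proof -
    have "\<bar>mean_bias {1..n} q S\<bar> \<le> (2 * real q powr (- 3 / 4)) ^ card (\<Union>S)"
      using that finite_subset[OF that finite_pairs] assms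
      by (intro abs_mean_bias_le) (auto simp: pairs_def)
    then have "\<bar>mean_bias {1..n} q S\<bar>\<^sup>2 \<le> ((2 * real q powr (- 3 / 4)) ^ card (\<Union>S))\<^sup>2"
      by (intro power_mono) auto
    also have "\<dots> = ((2 * real q powr (- 3 / 4))\<^sup>2) ^ card (\<Union>S)"
      by (simp only: power_mult[symmetric] mult.commute)
    finally show ?thesis by (simp only: power2_abs s)
  qed
  then have "(\<Sum>S\<in>{S. S \<subseteq> pairs n \<and> card S \<le> d} - {{}}. (mean_bias {1..n} q S)\<^sup>2) \<le>
    (\<Sum>S\<in>{S. S \<subseteq> pairs n \<and> card S \<le> d} - {{}}. (4 * real q powr (- 3 / 2)) ^ card (\<Union>S))"
    by (intro sum_mono) auto
  also have "\<dots> \<le> exp (real n * (4 * real q powr (- 3 / 2) * (1 + 4 * real d ^ 2) powr sqrt (real d))) - 1"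
    by (rule sum_edge_sets_le) simp
  finally show ?thesis .
qed

section \<open>Asymptotics in the number of vertices\<close>

text \<open>Take logarithms, with \<open>x = ln n\<close> and \<open>y = ln (ln n)\<close>:
  \<open>sqrt D\<close> is at most a small multiple of \<open>x / y\<close> and
  \<open>ln (1 + 4 * D ^ 2)\<close> is at most \<open>6 * y\<close>, so their product is a small
  multiple of \<open>x\<close>. The growth condition on \<open>D\<close> serves exactly
  this.\<close>

lemma edge_set_count_subpolynomial:
  fixes D :: "nat \<Rightarrow> nat" and \<epsilon> :: real
  assumes "\<epsilon> > 0"
    and D: "(\<lambda>n. real (D n)) \<in> o(\<lambda>n. (ln (real n) / ln (ln (real n)))\<^sup>2)"
  shows "\<forall>\<^sub>F n in sequentially.
    (1 + 4 * real (D n) ^ 2) powr sqrt (real (D n)) \<le> real n powr \<epsilon>"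
proof -
  \<comment> \<open>\<open>6 * c \<le> \<epsilon>\<close> absorbs the 6 of the bound
    \<open>6 * y\<close>; the cap at 1 gives the crude estimate of \<open>D n\<close> by the square
    of \<open>ln n\<close>.\<close>
  define c where "c = min 1 (\<epsilon> / 6)"
  have c: "0 < c" "c \<le> 1" "6 * c \<le> \<epsilon>" using \<open>\<epsilon> > 0\<close> by (auto simp: c_def)
  have "0 < c\<^sup>2" using c by simp
  from landau_o.smallD[OF D this]
  have "\<forall>\<^sub>F n in sequentially. real (D n) \<le> c\<^sup>2 * (ln (real n) / ln (ln (real n)))\<^sup>2"
    by simp
  moreover have "\<forall>\<^sub>F n in sequentially. 1 \<le> ln (ln (real n))"
  proof -
    have "filterlim (\<lambda>n. ln (ln (real n))) at_top sequentially"
      by (intro filterlim_compose[OF ln_at_top] filterlim_real_sequentially)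
    then show ?thesis by (simp add: filterlim_at_top)
  qed
  moreover have "\<forall>\<^sub>F n in sequentially. 3 \<le> n" by (rule eventually_ge_at_top)
  ultimately show ?thesis
  proof eventually_elim
    case (elim n)
    define x where "x = ln (real n)"
    define y where "y = ln x"
    have y: "1 \<le> y" using elim(2) by (simp add: x_def y_def)
    have "x > 0" using elim(3) by (simp add: x_def)
    then have xy: "x = exp y" by (simp add: y_def)
    have x: "1 \<le> x" using exp_ge_add_one_self[of y] y by (simp add: xy)
    have Dle: "real (D n) \<le> (c * (x / y))\<^sup>2" using elim(1) by (simp only: x_def y_def power_mult_distrib)
    have "sqrt (real (D n)) \<le> c * (x / y)"
      using Dle c x y by (intro real_le_lsqrt) auto
    moreover have "ln (1 + 4 * real (D n) ^ 2) \<le> 6 * y"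
    proof -
      have "c * (x / y) \<le> 1 * (x / 1)"
        using c x y by (intro mult_mono divide_left_mono) auto
      then have "(c * (x / y))\<^sup>2 \<le> x\<^sup>2" using c x y by (intro power_mono) auto
      then have "real (D n) \<le> x\<^sup>2" using Dle by simp
      then have "real (D n) ^ 2 \<le> (x\<^sup>2)\<^sup>2" by (intro power_mono) auto
      moreover have "1 \<le> (x\<^sup>2)\<^sup>2" using x by (simp add: one_le_power)
      ultimately have "1 + 4 * real (D n) ^ 2 \<le> 5 * (x\<^sup>2)\<^sup>2" by linarith
      \<comment> \<open>The constant 5 becomes a summand 2 in the exponent, and
        \<open>1 \<le> y\<close> turns \<open>2 + 4 * y\<close> into at most
        \<open>6 * y\<close>.\<close>
      also have "5 \<le> exp (2 :: real)"
        using exp_lower_Taylor_quadratic[of 2] by simp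
      then have "5 * (x\<^sup>2)\<^sup>2 \<le> exp 2 * (x\<^sup>2)\<^sup>2" by (intro mult_right_mono) auto
      also have "\<dots> = exp (2 + 4 * y)"
        by (simp add: xy exp_add flip: exp_of_nat_mult power_mult)
      also have "\<dots> \<le> exp (6 * y)" using y by simp
      finally have "ln (1 + 4 * real (D n) ^ 2) \<le> ln (exp (6 * y))"
        by (subst ln_le_cancel_iff) (auto simp: add_pos_nonneg)
      then show ?thesis by simp
    qed
    ultimately have "sqrt (real (D n)) * ln (1 + 4 * real (D n) ^ 2) \<le> (c * (x / y)) * (6 * y)"
      using c x y by (intro mult_mono) (auto simp: ln_ge_zero)
    also have "\<dots> = 6 * c * x" using y by simp
    also have "\<dots> \<le> \<epsilon> * x" using c x by (intro mult_right_mono) auto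
    finally show ?case
      using elim(3) by (simp add: powr_def x_def add_pos_nonneg less_imp_neq[symmetric])
  qed
qed

text \<open>The lower bound on \<open>q\<close> makes \<open>n * q^(-3/2)\<close> at most
  \<open>n^(-3 * \<epsilon> / 2)\<close>, and the count of edge sets costs back only
  \<open>n^\<epsilon>\<close>, leaving \<open>n^(-\<epsilon> / 2)\<close>. The exponent 2/3 is the
  point where \<open>n * q^(-3/2)\<close> stays constant.\<close>

lemma squared_bias_exponent_tendsto:
  fixes q D :: "nat \<Rightarrow> nat" and \<epsilon> :: real
  assumes "\<epsilon> > 0"
    and q: "\<forall>\<^sub>F n in sequentially. real (q n) \<ge> real n powr (2 / 3 + \<epsilon>)"
    and D: "(\<lambda>n. real (D n)) \<in> o(\<lambda>n. (ln (real n) / ln (ln (real n)))\<^sup>2)"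
  shows "(\<lambda>n. real n * (4 * real (q n) powr (- 3 / 2) *
    (1 + 4 * real (D n) ^ 2) powr sqrt (real (D n)))) \<longlonglongrightarrow> 0"
proof (rule tendsto_sandwich[OF _ _ tendsto_const])
  show "\<forall>\<^sub>F n in sequentially. 0 \<le> real n * (4 * real (q n) powr (- 3 / 2) *
    (1 + 4 * real (D n) ^ 2) powr sqrt (real (D n)))"
    by (intro always_eventually allI mult_nonneg_nonneg) auto
  show "\<forall>\<^sub>F n in sequentially. real n * (4 * real (q n) powr (- 3 / 2) *
    (1 + 4 * real (D n) ^ 2) powr sqrt (real (D n))) \<le> 4 * real n powr (- (\<epsilon> / 2))"
    using q edge_set_count_subpolynomial[OF \<open>\<epsilon> > 0\<close> D] eventually_gt_at_top[of 0]
  proof eventually_elim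
    case (elim n)
    have "real (q n) powr (- 3 / 2) \<le> (real n powr (2 / 3 + \<epsilon>)) powr (- 3 / 2)"
      using elim by (intro powr_mono2') auto
    also have "\<dots> = real n powr (- 1 - 3 / 2 * \<epsilon>)"
      by (simp add: powr_powr algebra_simps)
    finally have "4 * real (q n) powr (- 3 / 2) *
        (1 + 4 * real (D n) ^ 2) powr sqrt (real (D n)) \<le>
      4 * real n powr (- 1 - 3 / 2 * \<epsilon>) * real n powr \<epsilon>"
      using elim by (intro mult_mono) auto
    then have "real n * (4 * real (q n) powr (- 3 / 2) *
        (1 + 4 * real (D n) ^ 2) powr sqrt (real (D n))) \<le>
      real n powr 1 * (4 * real n powr (- 1 - 3 / 2 * \<epsilon>) * real n powr \<epsilon>)"
      by (simp add: mult_left_mono)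
    also have "\<dots> = 4 * (real n powr 1 * real n powr (- 1 - 3 / 2 * \<epsilon>) * real n powr \<epsilon>)"
      by simp
    also have "\<dots> = 4 * real n powr (- (\<epsilon> / 2))"
      by (simp only: powr_add[symmetric]) (simp add: field_simps)
    finally show ?case .
  qed
  have "(\<lambda>n. real n powr (- (\<epsilon> / 2))) \<longlonglongrightarrow> 0"
    using \<open>\<epsilon> > 0\<close> by (intro tendsto_neg_powr filterlim_real_sequentially) auto
  from tendsto_mult_left[OF this, of 4]
  show "(\<lambda>n. 4 * real n powr (- (\<epsilon> / 2))) \<longlonglongrightarrow> 0" by simp
qed

lemma expectation_G_half: "measure_pmf.expectation (G_half n) f = avg (graphs n) f"
  unfolding G_half_def avg_def
  by (rule integral_pmf_of_set[OF graphs_nonempty finite_graphs])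

theorem theorem2p18:
  fixes \<epsilon> :: real and q D :: "nat \<Rightarrow> nat"
  assumes "\<epsilon> > 0"
    and "\<forall>\<^sub>F n in sequentially. real (q n) \<ge> real n powr (2 / 3 + \<epsilon>)"
    and "(\<lambda>n. real (D n)) \<in> o(\<lambda>n. (ln (real n) / ln (ln (real n)))\<^sup>2)"
  shows "\<not> (\<exists>f. (\<forall>\<^sub>F n in sequentially. total_degree (f n) \<le> D n) \<and>
               weakly_separates f G_half (\<lambda>n. colorable n (q n)))"
proof
  assume "\<exists>f. (\<forall>\<^sub>F n in sequentially. total_degree (f n) \<le> D n) \<and>
    weakly_separates f G_half (\<lambda>n. colorable n (q n))"
  then obtain f where deg: "\<forall>\<^sub>F n in sequentially. total_degree (f n) \<le> D n"
    and vars: "\<forall>\<^sub>F n in sequentially. poly_vars (f n) \<subseteq> pairs n"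
    and ge: "\<forall>\<^sub>F n in sequentially. \<forall>X\<in>colorable n (q n). poly_eval (f n) X \<ge> 1"
    and zero: "\<forall>\<^sub>F n in sequentially. avg (graphs n) (poly_eval (f n)) = 0"
    and O1: "(\<lambda>n. avg (graphs n) (\<lambda>X. (poly_eval (f n) X)\<^sup>2)) \<in> O(\<lambda>_. 1)"
    unfolding weakly_separates_def expectation_G_half by blast
  from O1 obtain M where M: "M > 0"
    and var: "\<forall>\<^sub>F n in sequentially. norm (avg (graphs n) (\<lambda>X. (poly_eval (f n) X)\<^sup>2)) \<le> M * norm (1 :: real)"
    by (elim landau_o.bigE)
  \<comment> \<open>The squared biases sum to at most \<open>exp (t n) - 1\<close>, which tends to
    0. Multiplied by the bound \<open>M\<close> on the second moment this drops below 1, against the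
    lower bound 1.\<close>
  define t where "t n = real n * (4 * real (q n) powr (- 3 / 2) *
    (1 + 4 * real (D n) ^ 2) powr sqrt (real (D n)))" for n
  have "t \<longlonglongrightarrow> 0"
    unfolding t_def by (rule squared_bias_exponent_tendsto[OF assms])
  then have "(\<lambda>n. M * (exp (t n) - 1)) \<longlonglongrightarrow> M * (exp 0 - 1)"
    by (intro tendsto_intros)
  then have "(\<lambda>n. M * (exp (t n) - 1)) \<longlonglongrightarrow> 0" by simp
  then have small: "\<forall>\<^sub>F n in sequentially. M * (exp (t n) - 1) < 1"
    by (rule order_tendstoD) simp
  have "\<forall>\<^sub>F n in sequentially. False"
    using deg vars ge zero var small assms(2) eventually_gt_at_top[of 0]
  proof eventually_elim
    case (elim n)
    have "0 < real n powr (2 / 3 + \<epsilon>)" using elim(8) by simp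
    then have "q n > 0" using elim(7) by (metis less_le_trans of_nat_0_less_iff)
    have "1 \<le> avg (graphs n) (\<lambda>X. (poly_eval (f n) X)\<^sup>2) *
      (\<Sum>S\<in>{S. S \<subseteq> pairs n \<and> card S \<le> D n} - {{}}. (mean_bias {1..n} (q n) S)\<^sup>2)"
      using elim by (intro separation_lower_bound \<open>q n > 0\<close>) auto
    also have "\<dots> \<le> M * (exp (t n) - 1)"
      unfolding t_def
      using elim(5) M by (intro mult_mono sum_mean_bias_le \<open>q n > 0\<close> sum_nonneg) auto
    finally show ?case using elim(6) by simp
  qed
  then show False by simp
qed

end
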